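(* Let $m\ge1$ and $\kappa_m=\sqrt{\ln(4m)/\pi}$. The series $\mathbf N^{\mathcal B}_m(z)$ is analytic in the domain $D=\{z\in\mathbb C: |z|<\frac1{2m},\ z\notin[\frac1{4m},\frac1{2m}]\}$, and as $z\to\frac1{4m}$ in $D$, $$\mathbf N^{\mathcal B}_m(z)=\frac{8m\kappa_m}{\sqrt{(1-4mz)\ln((1-4mz)^{-1})}}+O\!\left(\frac{1}{\sqrt{(1-4mz)\ln^3((1-4mz)^{-1})}}\right).$$
   Context: An $m$-labeled binary tree is a non-empty finite rooted tree with node labels in $\{1,\dots,m\}$ in which every node has an optional left and an optional right child (distinguished); its size is its number of edges; $\mathcal B_{m,n}$ is the set of such trees of size $n$. For such a tree $t$, $\|\mathrm{dag}(t)\|$ denotes the number of distinct subtrees of $t$ (subtree = a node with all its descendants), i.e. the number of nodes of its minimal dag. $\mathbf N^{\mathcal B}_m(z)=\sum_{n\ge0}\big(\sum_{t\in\mathcal B_{m,n}}\|\mathrm{dag}(t)\|\big)z^n$. Logarithms and square roots are principal branches. *)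

theory Defs
  imports "HOL-Analysis.Analysis" "HOL-Library.Tree" "HOL-Library.Landau_Symbols"
begin

text \<open>An m-labeled binary tree is a non-empty tree (not Leaf) of type nat tree whose
  node labels lie in {1..m}; Leaf encodes an absent child. Its size (number of edges)
  is the number of nodes minus one.\<close>

definition labeled_btrees :: "nat \<Rightarrow> nat \<Rightarrow> nat tree set" where
  "labeled_btrees m n = {t. t \<noteq> Leaf \<and> set_tree t \<subseteq> {1..m} \<and> size t = n + 1}"

text \<open>Number of distinct (non-empty) subtrees = number of nodes of the minimal dag.\<close>
definition dag_size :: "nat tree \<Rightarrow> nat" where
  "dag_size t = card (subtrees t - {Leaf})"

definition NB_coeff :: "nat \<Rightarrow> nat \<Rightarrow> nat" where
  "NB_coeff m n = (\<Sum>t\<in>labeled_btrees m n. dag_size t)"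

definition kappa :: "nat \<Rightarrow> real" where
  "kappa m = sqrt (ln (4 * real m) / pi)"

definition domD :: "nat \<Rightarrow> complex set" where
  "domD m = {z. norm z < 1 / (2 * real m) \<and>
      z \<notin> complex_of_real ` {1 / (4 * real m) .. 1 / (2 * real m)}}"

end

theory Submission
  imports Defs "HOL-Complex_Analysis.Complex_Analysis" "HOL-Real_Asymp.Real_Asymp"
begin

text \<open>
  With \<open>c\<^sub>k\<close> the Catalan numbers, there are \<open>A\<^sub>k = c\<^sub>k m\<^sup>k\<close> trees with \<open>k\<close> nodes. For a tree \<open>u\<close> with
  \<open>k\<close> nodes, the series \<open>U\<close> of the trees avoiding \<open>u\<close> satisfies \<open>U = 1 + m z U\<^sup>2 - z\<^sup>k\<close>. Write
  \<open>a = 1 - 4mz\<close>, \<open>s = csqrt a\<close> and \<open>S\<^sub>k = s + csqrt (a + 4m z\<^sup>k\<^sup>+\<^sup>1)\<close>. Then the trees containing \<open>u\<close>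
  have series \<open>2 z\<^sup>k / S\<^sub>k\<close>, so the generating function is the sum over \<open>k \<ge> 1\<close> of
  \<open>2 A\<^sub>k z\<^sup>k\<^sup>-\<^sup>1 / S\<^sub>k\<close> for \<open>|z| < 1/(4m)\<close>. That sum diverges for larger \<open>|z|\<close>, but
  \<open>2/S\<^sub>k = 1/s - 4m z\<^sup>k\<^sup>+\<^sup>1 / (s S\<^sub>k\<^sup>2)\<close> splits off a closed form and leaves terms
  \<open>A\<^sub>k z\<^sup>2\<^sup>k / S\<^sub>k\<^sup>2\<close>, whose sum converges since \<open>4m |z|\<^sup>2 < 1\<close>. The two radicands of \<open>S\<^sub>k\<close> lie in the
  same closed half-plane, hence \<open>|S\<^sub>k|\<^sup>2 \<ge> |a|\<close> and \<open>|S\<^sub>k|\<^sup>2 \<ge> 4m |z|\<^sup>k\<^sup>+\<^sup>1\<close>, uniformly up to the slit.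

  Near \<open>1/(4m)\<close> take \<open>K\<close> with \<open>(4m)\<^sup>K \<le> 1/|a| < (4m)\<^sup>K\<^sup>+\<^sup>1\<close>. The terms with \<open>k \<le> K\<close>, taken in the first
  form, and the corrections with \<open>k > K\<close> contribute \<open>O(K\<^sup>-\<^sup>3\<^sup>/\<^sup>2)\<close> after multiplication by \<open>s\<close>. What remains is
  the Catalan tail \<open>4m \<Sum>\<^sub>k\<^sub>>\<^sub>K c\<^sub>k/4\<^sup>k\<close>, which telescopes to a central binomial coefficient, of
  order \<open>K\<^sup>-\<^sup>1\<^sup>/\<^sup>2\<close> by Wallis' product.
\<close>

section \<open>Scaled Catalan numbers\<close>

text \<open>\<open>cbin n\<close> is \<open>(2n choose n) / 4\<^sup>n\<close>, and \<open>catn n\<close> is the \<open>n\<close>-th Catalan number divided by \<open>4\<^sup>n\<close>.\<close>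

definition cbin :: "nat \<Rightarrow> real" where
  "cbin n = (\<Prod>k<n. (2 * real k + 1) / (2 * real k + 2))"

definition catn :: "nat \<Rightarrow> real" where
  "catn n = cbin n / (real n + 1)"

lemma cbin_0 [simp]: "cbin 0 = 1" and cbin_Suc: "cbin (Suc n) = cbin n * ((2 * real n + 1) / (2 * real n + 2))"
  by (simp_all add: cbin_def)

lemma cbin_pos: "cbin n > 0"
  unfolding cbin_def by (intro prod_pos) auto

lemma catn_pos: "catn n > 0"
  by (simp add: catn_def cbin_pos)

lemma catn_0 [simp]: "catn 0 = 1"
  by (simp add: catn_def)

lemma catn_Suc: "catn (Suc n) = catn n * ((2 * real n + 1) / (2 * (real n + 2)))"
  by (simp add: catn_def cbin_Suc field_simps)

text \<open>Each \<open>catn k\<close> is \<open>2 * (cbin k - cbin (Suc k))\<close>, so the sum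
  telescopes.\<close>

lemma sum_catn: "(\<Sum>k<n. catn k) = 2 - 2 * cbin n"
proof (induction n)
  case (Suc n)
  have "2 * cbin n - 2 * cbin (Suc n) = catn n"
    by (simp add: catn_def cbin_Suc field_simps)
  with Suc show ?case by simp
qed simp

lemma catn_antimono: "j \<le> k \<Longrightarrow> catn k \<le> catn j"
proof (induction k rule: dec_induct)
  case (step n)
  have "(2 * real n + 1) / (2 * (real n + 2)) \<le> 1" by (simp add: field_simps)
  then have "catn (Suc n) \<le> catn n"
    unfolding catn_Suc by (intro mult_left_le less_imp_le[OF catn_pos])
  with step show ?case by simp
qed simp

lemma catn_le_1: "catn n \<le> 1"
  using catn_antimono[of 0 n] by simp

text \<open>\<open>catn n\<close> is -2 times the coefficient of x^(n+1) in sqrt(1-x); this form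
  makes Vandermonde's identity applicable.\<close>

lemma catn_gbinomial: "catn n = 2 * (-1) ^ n * ((1/2) gchoose Suc n)"
proof (induction n)
  case (Suc n)
  have "((1/2::real) gchoose Suc (Suc n)) * (real n + 2) = ((1/2) gchoose Suc n) * (1/2 - real (Suc n))"
    using gbinomial_absorb_comp[of "1/2::real" "Suc n"] gbinomial_absorption[of "Suc n" "1/2::real"]
     gbinomial_mult_1[of "1/2::real" "Suc n"]
    by (simp add: algebra_simps)
  then have "((1/2::real) gchoose Suc (Suc n)) = ((1/2) gchoose Suc n) * (1/2 - real (Suc n)) / (real n + 2)"
    by (simp add: field_simps)
  then show ?case
    unfolding catn_Suc Suc.IH by (simp add: divide_simps del: gbinomial_Suc) (simp add: algebra_simps)
qed simp

text \<open>The square of the binomial series of sqrt(1+x) is 1+x, so its coefficients of degree at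
  least 2 vanish. The divisor 4 comes from the scaling of the Catalan numbers.\<close>

lemma catn_convolution: "catn (Suc n) = (\<Sum>i\<le>n. catn i * catn (n - i)) / 4"
proof -
  define g where "g i = ((1/2::real) gchoose i)" for i
  have gS: "g (Suc i) = (-1) ^ i * catn i / 2" for i
    unfolding g_def catn_gbinomial by (simp add: power_mult_distrib[symmetric] flip: mult.assoc)
  have "(\<Sum>k\<le>Suc (Suc n). g k * g (Suc (Suc n) - k)) = ((1/2 + 1/2) gchoose Suc (Suc n))"
    unfolding g_def unfolding gbinomial_Vandermonde atMost_atLeast0 ..
  also have "\<dots> = real (1 choose Suc (Suc n))"
    unfolding binomial_gbinomial by simp
  finally have "(\<Sum>k\<le>Suc (Suc n). g k * g (Suc (Suc n) - k)) = 0" by simp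
  \<comment> \<open>Both end terms equal \<open>g (Suc (Suc n))\<close> because
    \<open>g 0 = 1\<close>; they produce \<open>catn (Suc n)\<close>.\<close>
  moreover have "(\<Sum>k\<le>Suc (Suc n). g k * g (Suc (Suc n) - k)) =
     2 * g (Suc (Suc n)) + (\<Sum>k\<le>n. g (Suc k) * g (Suc (n - k)))"
    by (subst sum.atMost_Suc_shift, subst sum.atMost_Suc) (auto simp: g_def Suc_diff_le intro!: sum.cong)
  moreover have "(\<Sum>k\<le>n. g (Suc k) * g (Suc (n - k))) = (-1) ^ n * (\<Sum>i\<le>n. catn i * catn (n - i)) / 4"
    unfolding sum_distrib_left sum_divide_distrib
    by (intro sum.cong refl) (auto simp: gS simp flip: power_add)
  ultimately have "(-1) ^ n * (\<Sum>i\<le>n. catn i * catn (n - i)) / 4 = (-1) ^ n * catn (Suc n)"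
    unfolding gS by simp
  then show ?thesis by simp
qed

text \<open>Expresses the partial Wallis products through \<open>cbin\<close>, so that their limit
  pi/2 becomes information on \<open>cbin\<close>.\<close>

lemma wallis_cbin: "(\<Prod>k=1..n. (4 * real k ^ 2) / (4 * real k ^ 2 - 1)) = 1 / (cbin n ^ 2 * (2 * real n + 1))"
proof (induction n)
  case (Suc n)
  have e: "(4 * real (Suc n) ^ 2 - 1) = (2 * real n + 1) * (2 * real n + 3)"
    by (simp add: power2_eq_square algebra_simps)
  have "(\<Prod>k=1..Suc n. (4 * real k ^ 2) / (4 * real k ^ 2 - 1)) =
      1 / (cbin n ^ 2 * (2 * real n + 1)) * ((4 * real (Suc n) ^ 2) / ((2 * real n + 1) * (2 * real n + 3)))"
    unfolding e[symmetric] Suc.IH[symmetric] by simp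
  also have "\<dots> = 1 / (cbin (Suc n) ^ 2 * (2 * real (Suc n) + 1))"
    using cbin_pos[of n] by (simp add: cbin_Suc divide_simps power2_eq_square) (simp add: algebra_simps)
  finally show ?case .
qed simp

text \<open>The partial Wallis products increase, hence stay below their limit pi/2.\<close>

lemma cbin_lower: "1 \<le> pi * cbin n ^ 2 * (real n + 1/2)"
proof -
  let ?W = "\<lambda>n. \<Prod>k=1..n. (4 * real k ^ 2) / (4 * real k ^ 2 - 1)"
  have "mono ?W"
  proof (rule incseq_SucI)
    fix n
    have p: "?W n > 0" unfolding wallis_cbin using cbin_pos[of n] by simp
    have "1 \<le> 4 * x / (4 * x - 1)" if "x \<ge> 1" for x :: real
      using that by (simp add: field_simps)
    from this[of "real (Suc n) ^ 2"]
    have "1 \<le> (4 * real (Suc n) ^ 2) / (4 * real (Suc n) ^ 2 - 1)"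
      using power_mono[of 1 "real (Suc n)" 2] by simp
    from mult_left_mono[OF this less_imp_le[OF p]]
    show "?W n \<le> ?W (Suc n)" by simp
  qed
  from incseq_le[OF this wallis] have "?W n \<le> pi / 2" .
  moreover have "cbin n ^ 2 * (2 * real n + 1) > 0"
    using cbin_pos[of n] by simp
  ultimately show ?thesis
    unfolding wallis_cbin by (simp add: pos_divide_le_eq algebra_simps)
qed

text \<open>The sequence \<open>cbin n ^ 2 * n\<close> increases, with ratio (2n+1)^2 / (4n(n+1))
  for positive n, and tends to 1/pi.\<close>

lemma cbin_upper: "pi * cbin n ^ 2 * real n \<le> 1"
proof -
  let ?W = "\<lambda>n. \<Prod>k=1..n. (4 * real k ^ 2) / (4 * real k ^ 2 - 1)"
  let ?X = "\<lambda>n. cbin n ^ 2 * real n"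
  have eq: "?X n = (real n / (2 * real n + 1)) / ?W n" for n
    unfolding wallis_cbin using cbin_pos[of n] by (simp add: field_simps)
  have "(\<lambda>n. real n / (2 * real n + 1)) \<longlonglongrightarrow> 1/2" by real_asymp
  from tendsto_divide[OF this wallis] have lim: "?X \<longlonglongrightarrow> 1 / pi"
    unfolding eq by simp
  have "incseq ?X"
  proof (rule incseq_SucI)
    fix n
    show "?X n \<le> ?X (Suc n)"
      using cbin_pos[of n] by (simp add: cbin_Suc divide_simps power2_eq_square) (simp add: algebra_simps mult_left_mono)
  qed
  from incseq_le[OF this lim] show ?thesis by (simp add: field_simps)
qed

section \<open>Trees avoiding a fixed subtree\<close>

text \<open>Counting nodes instead of edges and admitting \<open>Leaf\<close> turns the
  decomposition at the root into a plain convolution.\<close>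

definition trees :: "nat \<Rightarrow> nat \<Rightarrow> nat tree set" where
  "trees m n = {t. set_tree t \<subseteq> {1..m} \<and> size t = n}"

text \<open>\<open>X\<close> is a parameter so that one counting argument serves both all trees and
  the trees avoiding a given one; \<open>n\<close> counts the nodes other than the root.\<close>

definition node_trees :: "nat \<Rightarrow> (nat \<Rightarrow> nat tree set) \<Rightarrow> nat \<Rightarrow> nat tree set" where
  "node_trees m X n = (\<Union>i\<le>n. (\<lambda>(a, l, r). Node l a r) ` ({1..m} \<times> X i \<times> X (n - i)))"

lemma trees_0: "trees m 0 = {Leaf}"
  by (auto simp: trees_def)

lemma trees_Suc: "trees m (Suc n) = node_trees m (trees m) n"
proof (intro equalityI subsetI)
  fix t assume t: "t \<in> trees m (Suc n)"
  then obtain l a r where [simp]: "t = Node l a r" by (cases t) (auto simp: trees_def)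
  from t show "t \<in> node_trees m (trees m) n"
    unfolding node_trees_def trees_def
    by (auto simp: image_iff intro!: bexI[of _ "size l"])
qed (auto simp: node_trees_def trees_def subset_iff)

lemma mem_node_trees_iff:
  "t \<in> node_trees m X n \<longleftrightarrow> (\<exists>i\<le>n. \<exists>a\<in>{1..m}. \<exists>l\<in>X i. \<exists>r\<in>X (n - i). t = Node l a r)"
  unfolding node_trees_def by (auto simp: image_iff Bex_def)

lemma finite_node_trees: "(\<And>i. finite (X i)) \<Longrightarrow> finite (node_trees m X n)"
  unfolding node_trees_def by auto

lemma finite_trees: "finite (trees m n)"
proof (induction n rule: less_induct)
  case (less n)
  show ?case
  proof (cases n)
    case (Suc k)
    have "finite (\<Union>i\<le>k. (\<lambda>(a, l, r). Node l a r) ` ({1..m} \<times> trees m i \<times> trees m (k - i)))"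
      using less Suc by auto
    with Suc show ?thesis by (simp add: trees_Suc node_trees_def)
  qed (simp add: trees_0)
qed

text \<open>The union over \<open>i\<close> is disjoint because \<open>i\<close> is the size of the
  left child.\<close>

lemma card_node_trees:
  assumes "\<And>i. X i \<subseteq> trees m i"
  shows "card (node_trees m X n) = m * (\<Sum>i\<le>n. card (X i) * card (X (n - i)))"
proof -
  let ?f = "\<lambda>(a, l, r). Node l a r :: nat tree"
  have fin: "finite (X i)" for i by (rule finite_subset[OF assms finite_trees])
  have inj: "inj_on ?f A" for A by (auto simp: inj_on_def)
  have "card (node_trees m X n) = (\<Sum>i\<le>n. card (?f ` ({1..m} \<times> X i \<times> X (n - i))))"
    unfolding node_trees_def
  proof (rule card_UN_disjoint)
    show "\<forall>i\<in>{..n}. \<forall>j\<in>{..n}. i \<noteq> j \<longrightarrow>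
       ?f ` ({1..m} \<times> X i \<times> X (n - i)) \<inter> ?f ` ({1..m} \<times> X j \<times> X (n - j)) = {}"
    proof (intro ballI impI, rule ccontr)
      fix i j
      assume "i \<noteq> j" "?f ` ({1..m} \<times> X i \<times> X (n - i)) \<inter> ?f ` ({1..m} \<times> X j \<times> X (n - j)) \<noteq> {}"
      then obtain l where "l \<in> X i" "l \<in> X j" by auto
      with assms[of i] assms[of j] \<open>i \<noteq> j\<close> show False by (auto simp: trees_def)
    qed
  qed (use fin in auto)
  also have "\<dots> = m * (\<Sum>i\<le>n. card (X i) * card (X (n - i)))"
    by (simp add: card_image[OF inj] card_cartesian_product sum_distrib_left)
  finally show ?thesis .
qed

lemma card_trees: "real (card (trees m n)) = (4 * real m) ^ n * catn n"
proof (induction n rule: less_induct)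
  case (less n)
  show ?case
  proof (cases n)
    case (Suc k)
    have "real (card (trees m n)) = m * (\<Sum>i\<le>k. real (card (trees m i)) * real (card (trees m (k - i))))"
      by (simp add: Suc trees_Suc card_node_trees)
    also have "(\<Sum>i\<le>k. real (card (trees m i)) * real (card (trees m (k - i)))) =
       (\<Sum>i\<le>k. (4 * real m) ^ k * (catn i * catn (k - i)))"
    proof (intro sum.cong refl)
      fix i assume "i \<in> {..k}"
      then show "real (card (trees m i)) * real (card (trees m (k - i))) = (4 * real m) ^ k * (catn i * catn (k - i))"
        using less.IH[of i] less.IH[of "k - i"] Suc power_add[of "4 * real m" i "k - i"]
        by (simp add: mult_ac)
    qed
    also have "real m * \<dots> = (4 * real m) ^ n * catn n"
      by (simp add: Suc catn_convolution flip: sum_distrib_left)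
    finally show ?thesis .
  qed (simp add: trees_0)
qed

definition avoiding :: "nat \<Rightarrow> nat tree \<Rightarrow> nat \<Rightarrow> nat tree set" where
  "avoiding m u n = {t \<in> trees m n. u \<notin> subtrees t}"

lemma avoiding_subset: "avoiding m u n \<subseteq> trees m n"
  by (auto simp: avoiding_def)

lemma card_avoiding_le: "card (avoiding m u n) \<le> card (trees m n)"
  by (rule card_mono[OF finite_trees avoiding_subset])

lemma avoiding_0: "u \<noteq> Leaf \<Longrightarrow> avoiding m u 0 = {Leaf}"
  by (auto simp: avoiding_def trees_0)

text \<open>A nonempty tree avoids \<open>u\<close> iff both children do and it differs from
  \<open>u\<close>. The children of \<open>u\<close> are too small to contain \<open>u\<close>, so
  exactly one candidate is lost, at size \<open>k\<close>.\<close>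

lemma card_avoiding_Suc:
  assumes u: "u \<in> trees m k" "k > 0"
  shows "card (avoiding m u (Suc n)) + (if Suc n = k then 1 else 0) =
           m * (\<Sum>i\<le>n. card (avoiding m u i) * card (avoiding m u (n - i)))"
proof -
  let ?N = "node_trees m (avoiding m u) n"
  have fin: "finite ?N"
    by (rule finite_node_trees[OF finite_subset[OF avoiding_subset finite_trees]])
  have eq: "avoiding m u (Suc n) = ?N - {u}"
    by (auto simp: avoiding_def trees_Suc mem_node_trees_iff) blast
  have iff: "u \<in> ?N \<longleftrightarrow> Suc n = k"
  proof
    assume "u \<in> ?N"
    then have "u \<in> trees m (Suc n)" unfolding trees_Suc mem_node_trees_iff avoiding_def by blast
    with u show "Suc n = k" by (simp add: trees_def)
  next
    assume k: "Suc n = k"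
    with u have "u \<in> node_trees m (trees m) n" by (simp flip: trees_Suc)
    then obtain i a l r where i: "i \<le> n" "a \<in> {1..m}" "l \<in> trees m i" "r \<in> trees m (n - i)" "u = Node l a r"
      by (auto simp: node_trees_def)
    then have "u \<notin> subtrees l" "u \<notin> subtrees r" by (auto dest: size_subtrees)
    with i show "u \<in> ?N"
      unfolding mem_node_trees_iff avoiding_def by blast
  qed
  have "card ?N = card (?N - {u}) + (if Suc n = k then 1 else 0)"
    using fin iff card_Suc_Diff1[of ?N u] by auto
  then show ?thesis by (simp add: eq card_node_trees avoiding_subset)
qed

lemma set_tree_subtrees: "u \<in> subtrees t \<Longrightarrow> set_tree u \<subseteq> set_tree t"
  by (induction t) auto

text \<open>Double counting of pairs of a tree and a subtree of it. The cutoff \<open>M\<close> is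
  free since a subtree has at most \<open>Suc n\<close> nodes; this later allows a range of sizes
  independent of \<open>n\<close>.\<close>

lemma NB_coeff_conv:
  assumes "Suc n \<le> M"
  shows "NB_coeff m n = (\<Sum>k=1..M. \<Sum>u\<in>trees m k. card (trees m (Suc n)) - card (avoiding m u (Suc n)))"
proof -
  let ?T = "trees m (Suc n)"
  let ?U = "\<Union>k\<in>{1..M}. trees m k"
  have lt: "labeled_btrees m n = ?T" by (auto simp: labeled_btrees_def trees_def)
  have finU: "finite ?U" by (auto intro: finite_trees)
  have sub: "subtrees t - {Leaf} = {u\<in>?U. u \<in> subtrees t}" if "t \<in> ?T" for t
  proof -
    have "u \<in> ?U" if u: "u \<in> subtrees t" "u \<noteq> Leaf" for u
    proof -
      have "size u > 0" using u(2) by (cases u) auto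
      moreover have "set_tree u \<subseteq> {1..m}" "size u \<le> M"
        using set_tree_subtrees[OF u(1)] size_subtrees[OF u(1)] assms \<open>t \<in> ?T\<close>
        by (auto simp: trees_def)
      ultimately show ?thesis by (auto simp: trees_def)
    qed
    then show ?thesis by (auto simp: trees_def)
  qed
  have "NB_coeff m n = (\<Sum>t\<in>?T. \<Sum>u\<in>?U. if u \<in> subtrees t then 1 else 0)"
    unfolding NB_coeff_def lt dag_size_def
  proof (intro sum.cong refl)
    fix t assume t: "t \<in> ?T"
    show "card (subtrees t - {Leaf}) = (\<Sum>u\<in>?U. if u \<in> subtrees t then 1 else 0)"
      unfolding sub[OF t] card_eq_sum by (rule sum.inter_filter[OF finU])
  qed
  also have "\<dots> = (\<Sum>u\<in>?U. \<Sum>t\<in>?T. if u \<in> subtrees t then 1 else 0)"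
    by (rule sum.swap)
  also have "\<dots> = (\<Sum>u\<in>?U. card ?T - card (avoiding m u (Suc n)))"
  proof (intro sum.cong refl)
    fix u
    have "?T \<inter> {t. u \<in> subtrees t} = ?T - avoiding m u (Suc n)" by (auto simp: avoiding_def)
    then show "(\<Sum>t\<in>?T. if u \<in> subtrees t then 1 else 0) = card ?T - card (avoiding m u (Suc n))"
      by (simp add: sum.If_cases finite_trees card_Diff_subset avoiding_subset finite_subset[OF avoiding_subset])
  qed
  also have "\<dots> = (\<Sum>k=1..M. \<Sum>u\<in>trees m k. card ?T - card (avoiding m u (Suc n)))"
    by (rule sum.UNION_disjoint) (auto simp: finite_trees, auto simp: trees_def)
  finally show ?thesis .
qed

section \<open>The square roots in the slit disc\<close>

text \<open>\<open>csqrt (avoid_disc m k z)\<close> is \<open>1 - 2mzU\<close> for the series \<open>U\<close> of trees avoiding a tree with \<open>k\<close> nodes.\<close>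

definition avoid_disc :: "nat \<Rightarrow> nat \<Rightarrow> complex \<Rightarrow> complex" where
  "avoid_disc m k z = 1 - 4 * of_nat m * z + 4 * of_nat m * z ^ (k + 1)"

definition csqrt_sum :: "nat \<Rightarrow> nat \<Rightarrow> complex \<Rightarrow> complex" where
  "csqrt_sum m k z = csqrt (1 - 4 * of_nat m * z) + csqrt (avoid_disc m k z)"

lemma abs_Im_power_le: "\<bar>Im (z ^ Suc n)\<bar> \<le> (real n + 1) * norm z ^ n * \<bar>Im z\<bar>"
proof (induction n)
  case (Suc n)
  have "\<bar>Im (z ^ Suc (Suc n))\<bar> \<le> \<bar>Re z\<bar> * \<bar>Im (z ^ Suc n)\<bar> + \<bar>Im z\<bar> * \<bar>Re (z ^ Suc n)\<bar>"
    unfolding power_Suc[of z "Suc n"] times_complex.sel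
    by (metis abs_mult abs_triangle_ineq)
  also have "\<dots> \<le> norm z * ((real n + 1) * norm z ^ n * \<bar>Im z\<bar>) + \<bar>Im z\<bar> * norm z ^ Suc n"
    using abs_Re_le_cmod[of z] abs_Re_le_cmod[of "z ^ Suc n"]
    by (intro add_mono mult_mono Suc.IH) (auto simp: norm_power norm_mult)
  finally show ?case by (simp add: algebra_simps)
qed simp

text \<open>The factor (k+1)|z|^k of the preceding bound is below (k+1)/2^k, which is at most 1. It
  keeps the two radicands of \<open>csqrt_sum\<close> on the same side of the real axis.\<close>

lemma abs_Im_power_less:
  assumes "norm z < 1/2" "k > 0" "Im z \<noteq> 0"
  shows "\<bar>Im (z ^ (k + 1))\<bar> < \<bar>Im z\<bar>"
proof -
  have k: "real k + 1 \<le> 2 ^ k"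
    using less_exp[of k] by (metis Suc_leI of_nat_Suc of_nat_le_iff of_nat_numeral of_nat_power add.commute)
  have "norm z ^ k < (1/2) ^ k"
    using assms by (intro power_strict_mono) auto
  then have "(real k + 1) * norm z ^ k < 2 ^ k * (1/2) ^ k"
    using k by (intro mult_le_less_imp_less) auto
  then have "(real k + 1) * norm z ^ k < 1" by (simp add: power_one_over)
  then have "(real k + 1) * norm z ^ k * \<bar>Im z\<bar> < 1 * \<bar>Im z\<bar>"
    using assms(3) by (intro mult_strict_right_mono) auto
  with abs_Im_power_le[of z k] show ?thesis by simp
qed

lemma domD_norm_less: "m \<ge> 1 \<Longrightarrow> z \<in> domD m \<Longrightarrow> norm z < 1/2"
proof -
  assume "m \<ge> 1" "z \<in> domD m"
  moreover from \<open>m \<ge> 1\<close> have "1 / (2 * real m) \<le> 1/2" by (simp add: field_simps)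
  moreover from \<open>z \<in> domD m\<close> have "norm z < 1 / (2 * real m)" by (simp add: domD_def)
  ultimately show ?thesis by linarith
qed

lemma domD_of_real_less:
  assumes "m \<ge> 1" "complex_of_real x \<in> domD m"
  shows "x < 1 / (4 * real m)"
  using assms by (force simp: domD_def)

text \<open>The value is a nonpositive real only for real \<open>z\<close> at or beyond 1/(4m),
  which is the slit.\<close>

lemma base_notin_nonpos:
  assumes "m \<ge> 1" "z \<in> domD m"
  shows "1 - 4 * of_nat m * z \<notin> \<real>\<^sub>\<le>\<^sub>0"
proof
  assume *: "1 - 4 * of_nat m * z \<in> \<real>\<^sub>\<le>\<^sub>0"
  then have "Im z = 0" "1 \<le> 4 * real m * Re z"
    using assms(1) by (auto simp: complex_nonpos_Reals_iff)
  then obtain x where "z = of_real x" "1 \<le> 4 * real m * x"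
    by (metis complex_is_Real_iff Re_complex_of_real Reals_cases)
  with domD_of_real_less[of m x] assms show False by (simp add: field_simps)
qed

lemma Im_avoid_disc: "Im (avoid_disc m k z) = - 4 * real m * (Im z - Im (z ^ (k + 1)))"
  by (simp add: avoid_disc_def algebra_simps del: power_Suc)

text \<open>A real value forces Im z = Im z^(k+1), hence \<open>z\<close> real by
  \<open>abs_Im_power_less\<close>; for real x < 1/(4m) the value is positive.\<close>

lemma avoid_disc_notin_nonpos:
  assumes "m \<ge> 1" "z \<in> domD m" "k > 0"
  shows "avoid_disc m k z \<notin> \<real>\<^sub>\<le>\<^sub>0"
proof
  assume *: "avoid_disc m k z \<in> \<real>\<^sub>\<le>\<^sub>0"
  note n = domD_norm_less[OF assms(1,2)]
  from * have "- 4 * real m * (Im z - Im (z ^ (k + 1))) = 0"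
    unfolding Im_avoid_disc[symmetric] by (simp add: complex_nonpos_Reals_iff)
  then have "Im z = Im (z ^ (k + 1))"
    using assms(1) by (simp only: mult_eq_0_iff) simp
  with abs_Im_power_less[OF n assms(3)] have "Im z = 0" by (metis less_irrefl)
  then obtain x where z: "z = of_real x" by (metis complex_is_Real_iff Reals_cases)
  with n have x: "\<bar>x\<bar> < 1/2" by simp
  have "x < 1 / (4 * real m)" using domD_of_real_less assms z by blast
  then have lt: "4 * real m * x < 1" using assms(1) by (simp add: field_simps)
  have "\<bar>x\<bar> ^ k \<le> 1 ^ k" using x by (intro power_mono) auto
  then have xk: "\<bar>x ^ k\<bar> \<le> 1" by (simp add: power_abs)
  have "avoid_disc m k z = of_real (1 - 4 * real m * x * (1 - x ^ k))"
    by (simp add: avoid_disc_def z algebra_simps)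
  with * have "1 \<le> 4 * real m * x * (1 - x ^ k)"
    by (simp add: complex_nonpos_Reals_iff)
  moreover have "4 * real m * x * (1 - x ^ k) < 1"
  proof (cases "x > 0")
    case True
    have "4 * real m * x * (1 - x ^ k) \<le> 4 * real m * x"
      using True by (intro mult_left_le) auto
    with lt show ?thesis by simp
  next
    case False
    then have "4 * real m * x \<le> 0" by (intro mult_nonneg_nonpos) auto
    then have "4 * real m * x * (1 - x ^ k) \<le> 0"
      using xk by (intro mult_nonpos_nonneg[of "4 * real m * x" "1 - x ^ k"]) auto
    then show ?thesis by linarith
  qed
  ultimately show False by simp
qed

lemma Re_csqrt_pos:
  assumes "z \<notin> \<real>\<^sub>\<le>\<^sub>0"
  shows "Re (csqrt z) > 0"
proof (rule ccontr)
  define w where "w = csqrt z"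
  have z: "z = w ^ 2" by (simp add: w_def)
  assume "\<not> Re (csqrt z) > 0"
  then have "Re w = 0" using Re_csqrt[of z] unfolding w_def by linarith
  then have "Re z \<le> 0" "Im z = 0" by (simp_all add: z Re_power2 Im_power2)
  with assms show False by (simp add: complex_nonpos_Reals_iff)
qed

lemma one_plus_csqrt_nonzero: "1 + csqrt z \<noteq> 0"
proof
  assume "1 + csqrt z = 0"
  then have "Re (1 + csqrt z) = 0" by (simp only: zero_complex.sel)
  with Re_csqrt[of z] show False by (simp del: csqrt.sel)
qed

text \<open>Both roots have positive real part, so the sign of Im a is that of the imaginary part of
  its root, and likewise for \<open>b\<close>. The cross term 2 Re(p * cnj q) in the expansion of
  the squared norm is therefore nonnegative.\<close>

lemma norm_csqrt_add_ge:
  assumes "a \<notin> \<real>\<^sub>\<le>\<^sub>0" "b \<notin> \<real>\<^sub>\<le>\<^sub>0" "Im a * Im b \<ge> 0"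
  shows "norm a + norm b \<le> norm (csqrt a + csqrt b) ^ 2"
proof -
  define p q where "p = csqrt a" and "q = csqrt b"
  have pos: "Re p > 0" "Re q > 0" unfolding p_def q_def by (intro Re_csqrt_pos assms)+
  have ab: "a = p ^ 2" "b = q ^ 2" by (simp_all add: p_def q_def)
  have "Im a * Im b = (4 * (Re p * Re q)) * (Im p * Im q)"
    by (simp add: ab power2_eq_square algebra_simps)
  moreover have "4 * (Re p * Re q) > 0" using pos by simp
  ultimately have "Im p * Im q \<ge> 0"
    using assms(3) zero_le_mult_iff[of "4 * (Re p * Re q)" "Im p * Im q"] by linarith
  moreover have "norm (p + q) ^ 2 = norm p ^ 2 + norm q ^ 2 + 2 * (Re p * Re q + Im p * Im q)"
    unfolding cmod_power2 by (simp add: power2_eq_square algebra_simps)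
  moreover have "Re p * Re q > 0" using pos by simp
  moreover have "norm a = norm p ^ 2" "norm b = norm q ^ 2" by (simp_all add: ab norm_power)
  ultimately show ?thesis unfolding p_def[symmetric] q_def[symmetric] by simp
qed

lemma norm_csqrt_sum_ge:
  assumes "m \<ge> 1" "z \<in> domD m" "k > 0"
  shows "norm (1 - 4 * of_nat m * z) \<le> norm (csqrt_sum m k z) ^ 2"
    and "4 * real m * norm z ^ (k + 1) \<le> norm (csqrt_sum m k z) ^ 2"
proof -
  have "Im z * (Im z - Im (z ^ (k + 1))) \<ge> 0"
  proof (cases "Im z = 0")
    case False
    have "c * (c - d) \<ge> 0" if "\<bar>d\<bar> < \<bar>c\<bar>" for c d :: real
      unfolding zero_le_mult_iff using that by arith
    from this[OF abs_Im_power_less[OF domD_norm_less[OF assms(1,2)] assms(3) False]]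
    show ?thesis .
  qed simp
  then have "0 \<le> 16 * real m ^ 2 * (Im z * (Im z - Im (z ^ (k + 1))))"
    by (intro mult_nonneg_nonneg[of "16 * real m ^ 2"]) auto
  moreover have "Im (1 - 4 * of_nat m * z) * Im (avoid_disc m k z) = 16 * real m ^ 2 * (Im z * (Im z - Im (z ^ (k + 1))))"
    unfolding Im_avoid_disc by (simp add: power2_eq_square)
  ultimately have "Im (1 - 4 * of_nat m * z) * Im (avoid_disc m k z) \<ge> 0" by (simp only:)
  from norm_csqrt_add_ge[OF base_notin_nonpos[OF assms(1,2)] avoid_disc_notin_nonpos[OF assms] this]
  have *: "norm (1 - 4 * of_nat m * z) + norm (avoid_disc m k z) \<le> norm (csqrt_sum m k z) ^ 2"
    by (simp add: csqrt_sum_def)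
  then show "norm (1 - 4 * of_nat m * z) \<le> norm (csqrt_sum m k z) ^ 2"
    using norm_ge_zero[of "avoid_disc m k z"] by linarith
  \<comment> \<open>The two radicands differ by exactly this term, so the sum of their norms
    dominates it.\<close>
  have "norm (4 * of_nat m * z ^ (k + 1)) \<le> norm (avoid_disc m k z) + norm (1 - 4 * of_nat m * z)"
    using norm_triangle_ineq4[of "avoid_disc m k z" "1 - 4 * of_nat m * z"] by (simp add: avoid_disc_def)
  with * show "4 * real m * norm z ^ (k + 1) \<le> norm (csqrt_sum m k z) ^ 2"
    by (simp add: norm_mult norm_power)
qed

lemma csqrt_sum_nonzero:
  assumes "m \<ge> 1" "z \<in> domD m" "k > 0"
  shows "csqrt_sum m k z \<noteq> 0"
  using norm_csqrt_sum_ge(1)[OF assms] base_notin_nonpos[OF assms(1,2)] by auto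

lemma norm_less_imp_in_domD: "m \<ge> 1 \<Longrightarrow> norm z < 1 / (4 * real m) \<Longrightarrow> z \<in> domD m"
proof -
  assume m: "m \<ge> 1" and z: "norm z < 1 / (4 * real m)"
  have "1 / (4 * real m) \<le> 1 / (2 * real m)" using m by (simp add: field_simps)
  with z show ?thesis unfolding domD_def by auto
qed

section \<open>Generating functions\<close>

lemma catn_power_series_le:
  assumes "0 \<le> r" "r \<le> 1"
  shows "summable (\<lambda>n. catn n * r ^ n)" "(\<Sum>n. catn n * r ^ n) \<le> 2"
proof -
  have le: "(\<Sum>i<n. catn i * r ^ i) \<le> 2" for n
  proof -
    have "(\<Sum>i<n. catn i * r ^ i) \<le> (\<Sum>i<n. catn i)"
      using assms by (intro sum_mono mult_left_le power_le_one less_imp_le[OF catn_pos])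
    also have "\<dots> \<le> 2" using cbin_pos[of n] by (simp add: sum_catn)
    finally show ?thesis .
  qed
  have nn: "0 \<le> catn n * r ^ n" for n using assms catn_pos[of n] by simp
  show "summable (\<lambda>n. catn n * r ^ n)" by (rule summableI_nonneg_bounded[OF nn le])
  then show "(\<Sum>n. catn n * r ^ n) \<le> 2" by (rule suminf_le_const[OF _ le])
qed

text \<open>
  The sequence \<open>d\<close> holds the coefficients of the inhomogeneity \<open>D\<close>: zero for all trees, \<open>z\<^sup>k\<close> for
  avoiding trees. The branch of the square root is forced because \<open>|U| \<le> \<Sum> c\<^sub>n/4\<^sup>n = 2\<close> gives
  \<open>|2mzU| < 1\<close>.
\<close>

lemma quadratic_gf:
  fixes v d :: "nat \<Rightarrow> real" and z D :: complex
  assumes m: "m \<ge> 1" and z: "norm z < 1 / (4 * real m)"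
    and v: "\<And>n. 0 \<le> v n" "\<And>n. v n \<le> (4 * real m) ^ n * catn n" "v 0 = 1"
    and rec: "\<And>n. v (Suc n) + d (Suc n) = real m * (\<Sum>i\<le>n. v i * v (n - i))"
    and d: "d 0 = 0" "(\<lambda>n. of_real (d n) * z ^ n) sums D"
  obtains U where "(\<lambda>n. of_real (v n) * z ^ n) sums U"
    "(\<lambda>n. of_real (v (Suc n) + d (Suc n)) * z ^ n) sums (of_nat m * U ^ 2)"
    "U = 1 + of_nat m * z * U ^ 2 - D"
    "csqrt (1 - 4 * of_nat m * z + 4 * of_nat m * z * D) = 1 - 2 * of_nat m * z * U"
proof -
  define r where "r = 4 * real m * norm z"
  have r: "0 \<le> r" "r < 1" using m z by (auto simp: r_def field_simps)
  have bound: "norm (of_real (v n) * z ^ n) \<le> catn n * r ^ n" for n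
    using mult_right_mono[OF v(2)[of n], of "norm z ^ n"] v(1)[of n]
    by (simp add: norm_mult norm_power r_def power_mult_distrib mult_ac)
  have sn: "summable (\<lambda>n. norm (of_real (v n) * z ^ n))"
    by (rule summable_comparison_test'[OF catn_power_series_le(1)[of r]]) (use r bound in auto)
  define U where "U = (\<Sum>n. of_real (v n) * z ^ n)"
  have U: "(\<lambda>n. of_real (v n) * z ^ n) sums U"
    unfolding U_def by (intro summable_sums summable_norm_cancel[OF sn])
  have "norm U \<le> (\<Sum>n. catn n * r ^ n)"
    unfolding U_def using bound r
    by (intro order_trans[OF summable_norm[OF sn]] suminf_le sn catn_power_series_le) auto
  also have "\<dots> \<le> 2" using r by (intro catn_power_series_le) auto
  finally have U2: "norm U \<le> 2" .
  have "(\<lambda>n. \<Sum>i\<le>n. (of_real (v i) * z ^ i) * (of_real (v (n - i)) * z ^ (n - i))) sums (U * U)"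
    unfolding U_def by (rule Cauchy_product_sums[OF sn sn])
  also have "(\<lambda>n. \<Sum>i\<le>n. (of_real (v i) * z ^ i) * (of_real (v (n - i)) * z ^ (n - i))) =
     (\<lambda>n. of_real (\<Sum>i\<le>n. v i * v (n - i)) * z ^ n)"
    unfolding of_real_sum sum_distrib_right
  proof (intro ext sum.cong refl)
    fix n i :: nat assume "i \<in> {..n}"
    then have "z ^ n = z ^ i * z ^ (n - i)" by (simp flip: power_add)
    then show "(of_real (v i) * z ^ i) * (of_real (v (n - i)) * z ^ (n - i)) = of_real (v i * v (n - i)) * z ^ n"
      by simp
  qed
  finally have "(\<lambda>n. of_real (real m * (\<Sum>i\<le>n. v i * v (n - i))) * z ^ n) sums (of_nat m * (U * U))"
    using sums_mult[of _ "U * U" "of_nat m :: complex"] by (simp add: mult.assoc)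
  then have sq: "(\<lambda>n. of_real (v (Suc n) + d (Suc n)) * z ^ n) sums (of_nat m * U ^ 2)"
    by (simp add: rec power2_eq_square)
  from sums_mult[OF this, of z]
  have "(\<lambda>n. of_real (v (Suc n) + d (Suc n)) * z ^ Suc n) sums (of_nat m * z * U ^ 2)"
    by (simp add: mult_ac)
  \<comment> \<open>The constant term 1 comes from \<open>v 0 = 1\<close> and
    \<open>d 0 = 0\<close>.\<close>
  from this[THEN sums_Suc] have "(\<lambda>n. of_real (v n + d n) * z ^ n) sums (of_nat m * z * U ^ 2 + 1)"
    using v d by simp
  moreover have "(\<lambda>n. of_real (v n + d n) * z ^ n) sums (U + D)"
    using sums_add[OF U d(2)] by (simp add: algebra_simps)
  ultimately have "U + D = of_nat m * z * U ^ 2 + 1" by (rule sums_unique2[symmetric])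
  then have quad: "U = 1 + of_nat m * z * U ^ 2 - D" by (simp add: algebra_simps)
  have "norm (2 * of_nat m * z * U) \<le> 2 * real m * norm z * 2"
    unfolding norm_mult using U2 by (intro mult_mono) auto
  also have "\<dots> < 1" using r by (simp add: r_def)
  finally have "Re (2 * of_nat m * z * U) < 1" using complex_Re_le_cmod order.strict_trans1 by blast
  then have Re: "Re (1 - 2 * of_nat m * z * U) > 0" by simp
  have "(1 - 2 * of_nat m * z * U) ^ 2 = 1 - 4 * of_nat m * z * (U - of_nat m * z * U ^ 2)"
    by (simp add: power2_eq_square algebra_simps)
  also have "U - of_nat m * z * U ^ 2 = 1 - D" using quad by (simp add: algebra_simps)
  finally have "(1 - 2 * of_nat m * z * U) ^ 2 = 1 - 4 * of_nat m * z + 4 * of_nat m * z * D"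
    by (simp add: algebra_simps)
  with Re have "csqrt (1 - 4 * of_nat m * z + 4 * of_nat m * z * D) = 1 - 2 * of_nat m * z * U"
    by (intro csqrt_unique) auto
  with U sq quad that show ?thesis by blast
qed

section \<open>Series of all trees and of the trees containing a fixed subtree\<close>

definition tree_count :: "nat \<Rightarrow> nat \<Rightarrow> real" where
  "tree_count m n = (4 * real m) ^ n * catn n"

lemma tree_count_nonneg: "0 \<le> tree_count m n"
  using catn_pos[of n] by (simp add: tree_count_def)

lemma tree_count_card: "tree_count m n = real (card (trees m n))"
  unfolding tree_count_def card_trees ..

lemma tree_count_0 [simp]: "tree_count m 0 = 1"
  by (simp add: tree_count_def)

lemma tree_count_Suc: "tree_count m (Suc n) = real m * (\<Sum>i\<le>n. tree_count m i * tree_count m (n - i))"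
proof -
  have "card (trees m (Suc n)) = m * (\<Sum>i\<le>n. card (trees m i) * card (trees m (n - i)))"
    unfolding trees_Suc by (rule card_node_trees) simp
  then have "real (card (trees m (Suc n))) = real m * (\<Sum>i\<le>n. real (card (trees m i)) * real (card (trees m (n - i))))"
    by simp
  then show ?thesis unfolding card_trees tree_count_def[symmetric] .
qed

text \<open>The case of \<open>quadratic_gf\<close> without inhomogeneity. Writing the root of the
  quadratic as 2/(1+s) instead of (1-s)/(2mz) avoids a division by \<open>z\<close>.\<close>

lemma tree_gf:
  assumes m: "m \<ge> 1" and z: "norm z < 1 / (4 * real m)"
  defines "s \<equiv> csqrt (1 - 4 * of_nat m * z)"
  shows "(\<lambda>n. of_real (tree_count m n) * z ^ n) sums (2 / (1 + s))"
    "(\<lambda>n. of_real (tree_count m (Suc n)) * z ^ n) sums (4 * of_nat m / (1 + s) ^ 2)"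
    "s = 1 - 2 * of_nat m * z * (2 / (1 + s))"
proof -
  obtain U where U: "(\<lambda>n. of_real (tree_count m n) * z ^ n) sums U"
    "(\<lambda>n. of_real (tree_count m (Suc n)) * z ^ n) sums (of_nat m * U ^ 2)"
    "U = 1 + of_nat m * z * U ^ 2" "s = 1 - 2 * of_nat m * z * U"
    by (rule quadratic_gf[OF m z, of "tree_count m" "\<lambda>_. 0" 0])
       (auto simp: tree_count_Suc tree_count_nonneg s_def, auto simp: tree_count_def)
  have "1 + s \<noteq> 0" unfolding s_def by (rule one_plus_csqrt_nonzero)
  moreover have "U * (1 + s) = 2"
  proof -
    have "U * (1 + s) = 2 * (U - of_nat m * z * U ^ 2)"
      unfolding U(4) by (simp add: power2_eq_square algebra_simps)
    also have "U - of_nat m * z * U ^ 2 = 1" using U(3) by (simp add: algebra_simps)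
    finally show ?thesis by simp
  qed
  ultimately have U_eq: "U = 2 / (1 + s)" by (simp add: field_simps)
  show "(\<lambda>n. of_real (tree_count m n) * z ^ n) sums (2 / (1 + s))"
    "s = 1 - 2 * of_nat m * z * (2 / (1 + s))"
    using U(1,4) unfolding U_eq .
  have "of_nat m * U ^ 2 = 4 * of_nat m / (1 + s) ^ 2" unfolding U_eq by (simp add: power_divide)
  with U(2) show "(\<lambda>n. of_real (tree_count m (Suc n)) * z ^ n) sums (4 * of_nat m / (1 + s) ^ 2)" by simp
qed

text \<open>With V for all trees and U for the avoiding ones, 2mz(V-U) is the difference of the two
  square roots, and multiplying by their sum leaves the difference 4m z^(k+2) of the radicands. The
  division by \<open>z\<close> passes from nodes to edges.\<close>

lemma containing_gf:
  assumes m: "m \<ge> 1" and z: "norm z < 1 / (4 * real m)" "z \<noteq> 0" and u: "u \<in> trees m (Suc k)"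
  shows "(\<lambda>n. of_nat (card (trees m (Suc n)) - card (avoiding m u (Suc n))) * z ^ n) sums
           (2 * z ^ k / csqrt_sum m (Suc k) z)"
proof -
  define s q where "s = csqrt (1 - 4 * of_nat m * z)" and "q = csqrt (avoid_disc m (Suc k) z)"
  define v where "v n = real (card (avoiding m u n))" for n
  define d :: "nat \<Rightarrow> real" where "d n = (if n = Suc k then 1 else 0)" for n
  from u have "u \<noteq> Leaf" by (auto simp: trees_def)
  have zD: "z \<in> domD m" using norm_less_imp_in_domD m z by blast
  have d_sums: "(\<lambda>n. of_real (d n) * z ^ n) sums (z ^ Suc k)"
    using sums_single[of "Suc k" "\<lambda>n. z ^ n"] by (simp add: d_def if_distrib[of of_real] if_distrib[of "\<lambda>x. x * _"] cong: if_cong)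
  have rec: "v (Suc n) + d (Suc n) = real m * (\<Sum>i\<le>n. v i * v (n - i))" for n
  proof -
    have "real (card (avoiding m u (Suc n)) + (if Suc n = Suc k then 1 else 0)) =
       real (m * (\<Sum>i\<le>n. card (avoiding m u i) * card (avoiding m u (n - i))))"
      unfolding card_avoiding_Suc[OF u zero_less_Suc] ..
    then show ?thesis by (simp add: v_def d_def split: if_splits)
  qed
  have v_le: "v n \<le> (4 * real m) ^ n * catn n" for n
    unfolding card_trees[symmetric] v_def using card_avoiding_le by simp
  obtain U where U: "(\<lambda>n. of_real (v n) * z ^ n) sums U"
    "csqrt (1 - 4 * of_nat m * z + 4 * of_nat m * z * z ^ Suc k) = 1 - 2 * of_nat m * z * U"
    by (rule quadratic_gf[OF m z(1) _ v_le _ rec _ d_sums])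
       (auto simp: v_def avoiding_0 \<open>u \<noteq> Leaf\<close> d_def)
  have q: "q = 1 - 2 * of_nat m * z * U" using U(2) by (simp add: q_def avoid_disc_def mult_ac)
  note T = tree_gf[OF m z(1), folded s_def]
  define V where "V = 2 / (1 + s)"
  have s: "s = 1 - 2 * of_nat m * z * V" using T(3) by (simp add: V_def)
  have "(\<lambda>n. of_real (tree_count m n) * z ^ n - of_real (v n) * z ^ n) sums (V - U)"
    using T(1) U(1) unfolding V_def by (rule sums_diff)
  then have "(\<lambda>n. of_real (tree_count m n - v n) * z ^ n) sums (V - U)"
    by (simp add: algebra_simps)
  \<comment> \<open>The term of index 0 vanishes, since \<open>Leaf\<close> avoids
    \<open>u\<close>.\<close>
  then have "(\<lambda>n. of_real (tree_count m (Suc n) - v (Suc n)) * z ^ Suc n) sums (V - U)"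
    by (subst sums_Suc_iff) (simp add: v_def avoiding_0 \<open>u \<noteq> Leaf\<close>)
  from sums_divide[OF this, of z]
  have "(\<lambda>n. of_real (tree_count m (Suc n) - v (Suc n)) * z ^ n) sums ((V - U) / z)"
    using z(2) by simp
  also have "(V - U) / z = 2 * z ^ k / csqrt_sum m (Suc k) z"
  proof -
    have "csqrt_sum m (Suc k) z \<noteq> 0" by (rule csqrt_sum_nonzero[OF m zD]) simp
    then have nz: "s + q \<noteq> 0" by (simp add: csqrt_sum_def s_def q_def)
    have "s ^ 2 = 1 - 4 * of_nat m * z" "q ^ 2 = avoid_disc m (Suc k) z" by (simp_all add: s_def q_def)
    then have "q ^ 2 - s ^ 2 = 4 * of_nat m * z ^ Suc (Suc k)"
      by (simp add: avoid_disc_def)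
    then have "(q - s) * (s + q) = 4 * of_nat m * z ^ Suc (Suc k)"
      by (simp add: power2_eq_square algebra_simps)
    moreover have "q - s = 2 * of_nat m * z * (V - U)"
      unfolding s q by (simp add: algebra_simps)
    ultimately have "(2 * of_nat m * z) * ((V - U) * (s + q)) = (2 * of_nat m * z) * (2 * z ^ k * z)"
      by (simp add: algebra_simps)
    then have "(V - U) * (s + q) = 2 * z ^ k * z"
      using m z(2) by (subst (asm) mult_cancel_left) auto
    with nz z(2) have "(V - U) / z = 2 * z ^ k / (s + q)" by (simp add: field_simps)
    then show ?thesis by (simp add: csqrt_sum_def s_def q_def)
  qed
  also have "(\<lambda>n. of_real (tree_count m (Suc n) - v (Suc n)) * z ^ n) =
     (\<lambda>n. of_nat (card (trees m (Suc n)) - card (avoiding m u (Suc n))) * z ^ n)"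
    by (simp add: of_nat_diff card_avoiding_le v_def tree_count_card)
  finally show ?thesis .
qed

lemma NB_coeff_eq_sum:
  assumes "n < M"
  shows "NB_coeff m n = (\<Sum>k<M. \<Sum>u\<in>trees m (Suc k). card (trees m (Suc n)) - card (avoiding m u (Suc n)))"
  using NB_coeff_conv[of n M m] assms
  by (simp add: sum.atLeast1_atMost_eq)

text \<open>Settles the point z = 0, which the division by \<open>z\<close> in
  \<open>containing_gf\<close> excludes.\<close>

lemma NB_coeff_0: "NB_coeff m 0 = m"
proof -
  have "NB_coeff m 0 = (\<Sum>u\<in>trees m 1. card (trees m 1) - card (avoiding m u 1))"
    using NB_coeff_conv[of 0 1 m] by simp
  also have "\<dots> = (\<Sum>u\<in>trees m 1. 1)"
  proof (intro sum.cong refl)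
    fix u assume u: "u \<in> trees m 1"
    then have "u \<noteq> Leaf" by (auto simp: trees_def)
    then have "card (avoiding m u 1) + 1 = m"
      using card_avoiding_Suc[OF u, of 0] by (simp add: avoiding_0)
    moreover have "card (trees m 1) = m"
      using card_node_trees[of "trees m" m 0] by (simp add: trees_Suc trees_0)
    ultimately show "card (trees m 1) - card (avoiding m u 1) = 1" by simp
  qed
  also have "\<dots> = m"
    using card_node_trees[of "trees m" m 0] by (simp add: trees_Suc trees_0)
  finally show ?thesis .
qed

text \<open>An exchange of the sums over the subtree size \<open>k\<close> and the tree size
  \<open>n\<close>. Absolute convergence is checked at the positive real point |z|, where all terms
  are nonnegative and the row sums are known in closed form.\<close>

lemma NB_gf_sums:
  assumes m: "m \<ge> 1" and z: "norm z < 1 / (4 * real m)" "z \<noteq> 0"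
    and G: "(\<lambda>k. of_real (tree_count m (Suc k)) * (2 * z ^ k / csqrt_sum m (Suc k) z)) sums G"
  shows "(\<lambda>n. of_nat (NB_coeff m n) * z ^ n) sums G"
proof -
  define h where "h k n = (\<Sum>u\<in>trees m (Suc k). card (trees m (Suc n)) - card (avoiding m u (Suc n)))" for k n
  define r where "r = norm z"
  have h_sums: "(\<lambda>n. of_nat (h k n) * w ^ n) sums (of_real (tree_count m (Suc k)) * (2 * w ^ k / csqrt_sum m (Suc k) w))"
    if "norm w < 1 / (4 * real m)" "w \<noteq> 0" for w :: complex and k
  proof -
    have "(\<lambda>n. \<Sum>u\<in>trees m (Suc k). of_nat (card (trees m (Suc n)) - card (avoiding m u (Suc n))) * w ^ n) sums
        (\<Sum>u\<in>trees m (Suc k). 2 * w ^ k / csqrt_sum m (Suc k) w)"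
      by (intro sums_sum containing_gf m that)
    then show ?thesis
      by (simp add: h_def tree_count_card sum_distrib_right del: of_nat_diff)
  qed
  have rD: "of_real r \<in> domD m"
    using norm_less_imp_in_domD[OF m, of "of_real r"] z by (simp add: r_def)
  define c where "c k = Re (of_real (tree_count m (Suc k)) * (2 * of_real r ^ k / csqrt_sum m (Suc k) (of_real r)))" for k
  have c_has_sum: "((\<lambda>n. real (h k n) * r ^ n) has_sum c k) UNIV" for k
  proof (rule sums_nonneg_imp_has_sum)
    have "(\<lambda>n. Re (of_nat (h k n) * of_real r ^ n)) sums c k"
      unfolding c_def by (rule sums_Re[OF h_sums]) (use z in \<open>auto simp: r_def\<close>)
    then show "(\<lambda>n. real (h k n) * r ^ n) sums c k"
      by (simp flip: of_real_power)
  qed (simp add: r_def)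
  have c_nonneg: "c k \<ge> 0" for k
    by (rule has_sum_nonneg[OF c_has_sum]) (simp add: r_def)
  have "summable c"
  proof (rule summable_comparison_test')
    \<comment> \<open>\<open>sqrt b\<close> bounds every \<open>csqrt_sum\<close> from below, so the
      row sums are dominated by the convergent series of all trees.\<close>
    define b where "b = norm (1 - 4 * of_nat m * complex_of_real r)"
    have b: "b > 0" using base_notin_nonpos[OF m rD] by (auto simp: b_def)
    have "norm (complex_of_real r) < 1 / (4 * real m)" using z by (simp add: r_def)
    from sums_summable[OF tree_gf(2)[OF m this]]
    have "summable (\<lambda>n. complex_of_real (tree_count m (Suc n) * r ^ n))" by simp
    then have "summable (\<lambda>n. tree_count m (Suc n) * r ^ n)" using summable_Re by fastforce
    then show "summable (\<lambda>n. tree_count m (Suc n) * r ^ n * (2 / sqrt b))" by (rule summable_mult2)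
    fix k
    have "b \<le> norm (csqrt_sum m (Suc k) (of_real r)) ^ 2"
      unfolding b_def by (rule norm_csqrt_sum_ge[OF m rD]) simp
    then have "sqrt b \<le> norm (csqrt_sum m (Suc k) (of_real r))" by (intro real_le_lsqrt) auto
    have "norm (c k) \<le> norm (of_real (tree_count m (Suc k)) * (2 * of_real r ^ k / csqrt_sum m (Suc k) (of_real r)))"
      unfolding c_def real_norm_def by (rule abs_Re_le_cmod)
    also have "\<dots> = tree_count m (Suc k) * r ^ k * (2 / norm (csqrt_sum m (Suc k) (of_real r)))"
      by (simp add: norm_mult norm_divide norm_power tree_count_nonneg r_def)
    also have "\<dots> \<le> tree_count m (Suc k) * r ^ k * (2 / sqrt b)"
      using b \<open>sqrt b \<le> _\<close>
      by (intro mult_left_mono divide_left_mono mult_nonneg_nonneg tree_count_nonneg)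
         (auto simp: r_def intro!: mult_pos_pos elim: order.strict_trans2[rotated])
    finally show "norm (c k) \<le> tree_count m (Suc k) * r ^ k * (2 / sqrt b)" .
  qed
  then have "c summable_on UNIV"
    using c_nonneg by (rule summable_nonneg_imp_summable_on)
  let ?F = "\<lambda>(k, n). of_nat (h k n) * z ^ n"
  have "(\<lambda>p. norm (?F p)) summable_on UNIV \<times> UNIV"
    by (rule summable_on_SigmaI[OF _ \<open>c summable_on UNIV\<close>])
       (use c_has_sum in \<open>auto simp: norm_mult norm_power r_def\<close>)
  then have F: "?F summable_on UNIV \<times> UNIV" by (rule abs_summable_summable)
  define S where "S = infsum ?F (UNIV \<times> UNIV)"
  have S: "(?F has_sum S) (UNIV \<times> UNIV)" unfolding S_def using F by simp
  have row: "((\<lambda>n. of_nat (h k n) * z ^ n) has_sum (of_real (tree_count m (Suc k)) * (2 * z ^ k / csqrt_sum m (Suc k) z))) UNIV" for k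
  proof (rule norm_summable_imp_has_sum[OF _ h_sums[OF z]])
    have "summable (\<lambda>n. real (h k n) * r ^ n)"
      using c_has_sum[of k] has_sum_imp_sums sums_summable by blast
    then show "summable (\<lambda>n. norm (of_nat (h k n) * z ^ n))"
      by (simp add: norm_mult norm_power r_def)
  qed
  have "((\<lambda>k. of_real (tree_count m (Suc k)) * (2 * z ^ k / csqrt_sum m (Suc k) z)) has_sum S) UNIV"
    by (rule has_sum_SigmaD[OF S]) (use row in auto)
  then have "S = G" using G has_sum_imp_sums sums_unique2 by blast
  have S': "((\<lambda>(n, k). ?F (k, n)) has_sum S) (UNIV \<times> UNIV)"
    using S by (subst (asm) has_sum_swap)
  have col: "((\<lambda>k. of_nat (h k n) * z ^ n) has_sum (of_nat (NB_coeff m n) * z ^ n)) UNIV" for n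
  proof (rule has_sum_finite_neutralI[of "{..<Suc n}"])
    \<comment> \<open>The cutoffs \<open>k\<close> and \<open>Suc k\<close> both exceed
      \<open>n\<close>, so the two sums agree and the extra term is 0.\<close>
    have hz: "h k n = 0" if "n < k" for k
      using NB_coeff_eq_sum[of n k m] NB_coeff_eq_sum[of n "Suc k" m] that by (simp add: h_def)
    have "NB_coeff m n = (\<Sum>k<Suc n. h k n)"
      unfolding h_def by (rule NB_coeff_eq_sum) simp
    then show "of_nat (NB_coeff m n) * z ^ n = (\<Sum>k<Suc n. of_nat (h k n) * z ^ n)"
      by (simp add: sum_distrib_right ring_distribs)
    show "of_nat (h k n) * z ^ n = 0" if "k \<in> UNIV - {..<Suc n}" for k
      using that hz[of k] by auto
  qed auto
  have "((\<lambda>n. of_nat (NB_coeff m n) * z ^ n) has_sum S) UNIV"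
    by (rule has_sum_SigmaD[OF S']) (use col in auto)
  with \<open>S = G\<close> show ?thesis using has_sum_imp_sums by blast
qed

section \<open>Analytic continuation\<close>

text \<open>The exponent 2(k+1) joins z^k from the term itself with z^(k+2) from the difference of
  the radicands.\<close>

definition corr_term :: "nat \<Rightarrow> nat \<Rightarrow> complex \<Rightarrow> complex" where
  "corr_term m k z = of_real (tree_count m (Suc k)) * z ^ (2 * Suc k) / csqrt_sum m (Suc k) z ^ 2"

text \<open>The first summand is the closed form of the Catalan part; it remains meaningful on the
  whole slit disc, where that series may diverge.\<close>

definition NB_fun :: "nat \<Rightarrow> complex \<Rightarrow> complex" where
  "NB_fun m z = (let s = csqrt (1 - 4 * of_nat m * z) in
     4 * of_nat m / (s * (1 + s) ^ 2) - 4 * of_nat m / s * (\<Sum>k. corr_term m k z))"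

lemma norm_corr_term_le:
  assumes "m \<ge> 1" "z \<in> domD m"
  shows "norm (corr_term m k z) \<le> catn (Suc k) * (4 * real m * norm z ^ 2) ^ Suc k / norm (1 - 4 * of_nat m * z)"
proof -
  have a: "norm (1 - 4 * of_nat m * z) > 0" using base_notin_nonpos[OF assms] by auto
  have "norm (corr_term m k z) = catn (Suc k) * (4 * real m * norm z ^ 2) ^ Suc k / norm (csqrt_sum m (Suc k) z) ^ 2"
    unfolding corr_term_def norm_mult norm_divide norm_power power_mult norm_of_real abs_of_nonneg[OF tree_count_nonneg]
    by (simp only: tree_count_def power_mult_distrib mult_ac)
  also have "\<dots> \<le> catn (Suc k) * (4 * real m * norm z ^ 2) ^ Suc k / norm (1 - 4 * of_nat m * z)"
    using norm_csqrt_sum_ge(1)[OF assms, of "Suc k"] a catn_pos[of "Suc k"]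
    by (intro divide_left_mono mult_nonneg_nonneg mult_pos_pos) auto
  finally show ?thesis .
qed

lemma norm_corr_term_le':
  assumes "m \<ge> 1" "z \<in> domD m"
  shows "norm (corr_term m k z) \<le> (4 * real m * norm z ^ 2) ^ Suc k / norm (1 - 4 * of_nat m * z)"
proof -
  have "catn (Suc k) * (4 * real m * norm z ^ 2) ^ Suc k \<le> (4 * real m * norm z ^ 2) ^ Suc k"
    by (intro mult_left_le_one_le catn_le_1 less_imp_le[OF catn_pos]) auto
  then show ?thesis
    by (intro order_trans[OF norm_corr_term_le[OF assms]] divide_right_mono) auto
qed

text \<open>Here the radius 1/(2m) enters: it makes the ratio of the majorizing geometric series
  less than 1.\<close>

lemma four_m_square_less_1:
  assumes "m \<ge> 1" "0 \<le> r" "r < 1 / (2 * real m)"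
  shows "4 * real m * r ^ 2 < 1"
proof -
  have "r ^ 2 < (1 / (2 * real m)) ^ 2" using assms by (intro power_strict_mono) auto
  then have "4 * real m * r ^ 2 < 4 * real m * (1 / (2 * real m)) ^ 2"
    using assms by (intro mult_strict_left_mono) auto
  also have "\<dots> = 1 / real m" using assms by (simp add: power2_eq_square field_simps)
  also have "\<dots> \<le> 1" using assms by simp
  finally show ?thesis .
qed

lemma summable_norm_corr_term:
  assumes "m \<ge> 1" "z \<in> domD m"
  shows "summable (\<lambda>k. norm (corr_term m k z))"
proof (rule summable_comparison_test')
  have "4 * real m * norm z ^ 2 < 1"
    using assms by (intro four_m_square_less_1) (auto simp: domD_def)
  then have "summable (\<lambda>k. (4 * real m * norm z ^ 2) ^ Suc k)"
    by (subst summable_Suc_iff, intro summable_geometric) auto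
  then show "summable (\<lambda>k. (4 * real m * norm z ^ 2) ^ Suc k / norm (1 - 4 * of_nat m * z))"
    by (rule summable_divide)
qed (use norm_corr_term_le'[OF assms] in auto)

lemma open_domD: "open (domD m)"
proof -
  have "domD m = ball 0 (1 / (2 * real m)) - complex_of_real ` {1 / (4 * real m) .. 1 / (2 * real m)}"
    by (auto simp: domD_def)
  moreover have "compact (complex_of_real ` {1 / (4 * real m) .. 1 / (2 * real m)})"
    by (intro compact_continuous_image continuous_intros) auto
  ultimately show ?thesis by (simp add: compact_imp_closed open_Diff)
qed

lemma corr_term_holomorphic:
  assumes "m \<ge> 1"
  shows "corr_term m k holomorphic_on domD m"
  unfolding corr_term_def csqrt_sum_def avoid_disc_def
  using assms base_notin_nonpos[OF assms] avoid_disc_notin_nonpos[OF assms, of _ "Suc k"] csqrt_sum_nonzero[OF assms, of _ "Suc k"]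
  by (intro holomorphic_intros) (auto simp: avoid_disc_def csqrt_sum_def)

text \<open>Weierstrass' M-test on closed discs. By compactness |z| attains a maximum and |1-4mz| a
  positive minimum there, which gives a uniform geometric majorant.\<close>

lemma corr_sum_holomorphic:
  assumes m: "m \<ge> 1"
  shows "(\<lambda>z. \<Sum>k. corr_term m k z) holomorphic_on domD m"
proof (rule holomorphic_uniform_sequence[OF open_domD])
  show "(\<lambda>z. \<Sum>k<n. corr_term m k z) holomorphic_on domD m" for n
    by (intro holomorphic_intros corr_term_holomorphic m)
  fix x assume "x \<in> domD m"
  then obtain d where d: "d > 0" "cball x d \<subseteq> domD m"
    using open_domD open_contains_cball by blast
  have ne: "cball x d \<noteq> {}" using d by auto
  obtain y where y: "y \<in> cball x d" "\<forall>z\<in>cball x d. norm z \<le> norm y"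
    using continuous_attains_sup[OF compact_cball ne continuous_on_norm_id] by blast
  obtain w where w: "w \<in> cball x d" "\<forall>z\<in>cball x d. norm (1 - 4 * of_nat m * w) \<le> norm (1 - 4 * of_nat m * z)"
  proof -
    have "continuous_on (cball x d) (\<lambda>z. norm (1 - 4 * of_nat m * z))" by (intro continuous_intros)
    from continuous_attains_inf[OF compact_cball ne this] that show ?thesis by blast
  qed
  define \<delta> where "\<delta> = norm (1 - 4 * of_nat m * w)"
  have "\<delta> > 0" using base_notin_nonpos[OF m, of w] w d by (auto simp: \<delta>_def)
  define q where "q = 4 * real m * norm y ^ 2"
  have q: "0 \<le> q" "q < 1"
    using m y d by (auto simp: q_def domD_def intro!: four_m_square_less_1)
  have "uniform_limit (cball x d) (\<lambda>n z. \<Sum>k<n. corr_term m k z) (\<lambda>z. \<Sum>k. corr_term m k z) sequentially"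
  proof (rule Weierstrass_m_test)
    have "summable (\<lambda>k. q ^ Suc k)"
      using q by (subst summable_Suc_iff, intro summable_geometric) auto
    then show "summable (\<lambda>k. q ^ Suc k / \<delta>)" by (rule summable_divide)
    fix k z assume z: "z \<in> cball x d"
    then have zD: "z \<in> domD m" using d by auto
    have "norm (corr_term m k z) \<le> (4 * real m * norm z ^ 2) ^ Suc k / norm (1 - 4 * of_nat m * z)"
      by (rule norm_corr_term_le'[OF m zD])
    also have "\<dots> \<le> q ^ Suc k / \<delta>"
      using \<open>\<delta> > 0\<close> y w z unfolding q_def \<delta>_def
      by (intro frac_le power_mono mult_left_mono) auto
    finally show "norm (corr_term m k z) \<le> q ^ Suc k / \<delta>" .
  qed
  with d show "\<exists>d>0. cball x d \<subseteq> domD m \<and>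
      uniform_limit (cball x d) (\<lambda>n z. \<Sum>k<n. corr_term m k z) (\<lambda>z. \<Sum>k. corr_term m k z) sequentially"
    by blast
qed

lemma NB_fun_analytic:
  assumes m: "m \<ge> 1"
  shows "NB_fun m analytic_on domD m"
proof -
  have "1 - 4 * of_nat m * z \<noteq> 0" if "z \<in> domD m" for z
    using base_notin_nonpos[OF m that] by auto
  then have "(\<lambda>z. 4 * of_nat m / (csqrt (1 - 4 * of_nat m * z) * (1 + csqrt (1 - 4 * of_nat m * z)) ^ 2)
     - 4 * of_nat m / csqrt (1 - 4 * of_nat m * z) * (\<Sum>k. corr_term m k z)) holomorphic_on domD m"
    using base_notin_nonpos[OF m] one_plus_csqrt_nonzero
    by (intro holomorphic_intros corr_sum_holomorphic m) auto
  then show ?thesis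
    by (simp add: analytic_on_open open_domD NB_fun_def[abs_def] Let_def)
qed

text \<open>With S = s + q one has 2s/S = 1 + (s-q)/S, and (s-q)S is minus the difference of the
  radicands.\<close>

lemma scaled_term_conv:
  assumes "m \<ge> 1" "z \<in> domD m"
  defines "s \<equiv> csqrt (1 - 4 * of_nat m * z)"
  shows "s * (of_real (tree_count m (Suc k)) * (2 * z ^ k / csqrt_sum m (Suc k) z)) =
     of_real (tree_count m (Suc k)) * z ^ k - 4 * of_nat m * corr_term m k z"
proof -
  define S q where "S = csqrt_sum m (Suc k) z" and "q = csqrt (avoid_disc m (Suc k) z)"
  have S: "S \<noteq> 0" "S = s + q"
    using csqrt_sum_nonzero[OF assms(1,2)] by (auto simp: S_def csqrt_sum_def s_def q_def)
  have "s ^ 2 = 1 - 4 * of_nat m * z" "q ^ 2 = avoid_disc m (Suc k) z" by (simp_all add: s_def q_def)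
  then have "q ^ 2 - s ^ 2 = 4 * of_nat m * z ^ Suc (Suc k)"
    by (simp add: avoid_disc_def)
  then have "(s - q) * S = - (4 * of_nat m * z ^ Suc (Suc k))"
    unfolding S(2) by (simp add: power2_eq_square algebra_simps)
  then have *: "s - q = - (4 * of_nat m * z ^ Suc (Suc k)) / S"
    using S(1) by (simp add: field_simps)
  have "s * (2 * z ^ k / S) = z ^ k + z ^ k * (s - q) / S"
    using S(1) unfolding S(2) by (simp add: field_simps)
  also have "\<dots> = z ^ k - 4 * of_nat m * z ^ (2 * Suc k) / S ^ 2"
    unfolding * by (simp add: power2_eq_square mult_2 power_add)
  finally have **: "s * (2 * z ^ k / S) = z ^ k - 4 * of_nat m * z ^ (2 * Suc k) / S ^ 2" .
  have "s * (of_real (tree_count m (Suc k)) * (2 * z ^ k / S)) = of_real (tree_count m (Suc k)) * (s * (2 * z ^ k / S))"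
    by (simp add: mult_ac)
  also have "\<dots> = of_real (tree_count m (Suc k)) * z ^ k - 4 * of_nat m * corr_term m k z"
    unfolding ** corr_term_def S_def[symmetric] by (simp add: algebra_simps)
  finally show ?thesis by (simp add: S_def)
qed

lemma NB_fun_sums_terms:
  assumes m: "m \<ge> 1" and z: "norm z < 1 / (4 * real m)"
  shows "(\<lambda>k. of_real (tree_count m (Suc k)) * (2 * z ^ k / csqrt_sum m (Suc k) z)) sums NB_fun m z"
proof -
  define s where "s = csqrt (1 - 4 * of_nat m * z)"
  have zD: "z \<in> domD m" by (rule norm_less_imp_in_domD[OF m z])
  have s: "s \<noteq> 0" using base_notin_nonpos[OF m zD] by (auto simp: s_def)
  have "(\<lambda>k. corr_term m k z) sums (\<Sum>k. corr_term m k z)"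
    by (intro summable_sums summable_norm_cancel[OF summable_norm_corr_term[OF m zD]])
  from sums_diff[OF tree_gf(2)[OF m z] sums_mult[OF this, of "4 * of_nat m"]]
  have "(\<lambda>k. s * (of_real (tree_count m (Suc k)) * (2 * z ^ k / csqrt_sum m (Suc k) z))) sums
     (4 * of_nat m / (1 + s) ^ 2 - 4 * of_nat m * (\<Sum>k. corr_term m k z))"
    unfolding s_def scaled_term_conv[OF m zD] .
  from sums_divide[OF this, of s] show ?thesis
    using s by (simp add: NB_fun_def Let_def diff_divide_distrib flip: s_def) (simp add: mult_ac)
qed

lemma NB_fun_0: "m \<ge> 1 \<Longrightarrow> NB_fun m 0 = of_nat m"
  by (simp add: NB_fun_def corr_term_def)

lemma NB_fun_sums:
  assumes m: "m \<ge> 1" and z: "norm z < 1 / (4 * real m)"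
  shows "(\<lambda>n. of_nat (NB_coeff m n) * z ^ n) sums NB_fun m z"
proof (cases "z = 0")
  case True
  then show ?thesis
    using powser_sums_zero[of "\<lambda>n. of_nat (NB_coeff m n) :: complex"] m by (simp add: NB_fun_0 NB_coeff_0)
next
  case False
  with NB_gf_sums[OF m z _ NB_fun_sums_terms[OF m z]] show ?thesis by blast
qed

text \<open>Undoes the conversion for the first \<open>K\<close> terms only, so that each term is
  kept in the form that is small in its range.\<close>

lemma NB_fun_split:
  assumes m: "m \<ge> 1" and z: "z \<in> domD m"
  defines "s \<equiv> csqrt (1 - 4 * of_nat m * z)"
  shows "s * NB_fun m z = s * (\<Sum>k<K. of_real (tree_count m (Suc k)) * (2 * z ^ k / csqrt_sum m (Suc k) z))
    + (4 * of_nat m / (1 + s) ^ 2 - (\<Sum>k<K. of_real (tree_count m (Suc k)) * z ^ k))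
    - 4 * of_nat m * (\<Sum>k. corr_term m (k + K) z)"
proof -
  have s: "s \<noteq> 0" using base_notin_nonpos[OF m z] by (auto simp: s_def)
  have E1: "(\<Sum>k. corr_term m k z) = (\<Sum>k. corr_term m (k + K) z) + (\<Sum>k<K. corr_term m k z)"
    by (rule suminf_split_initial_segment[OF summable_norm_cancel[OF summable_norm_corr_term[OF m z]]])
  have E2: "s * NB_fun m z = 4 * of_nat m / (1 + s) ^ 2 - 4 * of_nat m * (\<Sum>k. corr_term m k z)"
    using s unfolding NB_fun_def Let_def s_def[symmetric] by (simp add: field_simps)
  have E3: "s * (\<Sum>k<K. of_real (tree_count m (Suc k)) * (2 * z ^ k / csqrt_sum m (Suc k) z)) =
     (\<Sum>k<K. of_real (tree_count m (Suc k)) * z ^ k) - 4 * of_nat m * (\<Sum>k<K. corr_term m k z)"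
    unfolding sum_distrib_left s_def scaled_term_conv[OF m z] sum_subtractf ..
  show ?thesis unfolding E2 E3 E1 by (simp add: ring_distribs)
qed

section \<open>Estimates near the singularity\<close>

text \<open>From index 2 on the summands grow by a factor of at least 5/4, so the last one
  dominates, with constant 1/(1 - 4/5) = 5. At index 1 the factor may be only 1, hence the separate
  case.\<close>

lemma catn_geometric_sum_le:
  assumes q: "(q::real) \<ge> 2" and "K \<ge> 1"
  shows "(\<Sum>k<K. catn (Suc k) * q ^ Suc k) \<le> 5 * (catn K * q ^ K)"
  using \<open>K \<ge> 1\<close>
proof (induction K rule: nat_induct_at_least)
  case base
  show ?case using q catn_pos[of 1] by simp
next
  case (Suc n)
  consider "n = 1" | "n \<ge> 2" using Suc.hyps by linarith
  then show ?case
  proof cases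
    case 1
    have "q * 2 \<le> q * q" using q by (intro mult_left_mono) auto
    then show ?thesis using q 1 by (simp add: catn_Suc power2_eq_square)
  next
    case 2
    have "5 * (catn n * q ^ n) \<le> 4 * (catn (Suc n) * q ^ Suc n)"
    proof -
      have pos: "catn n * q ^ n \<ge> 0" using q catn_pos[of n] by simp
      have "5 * (2 * (real n + 2)) \<le> 4 * (2 * (2 * real n + 1))" using 2 by simp
      also have "\<dots> \<le> 4 * (q * (2 * real n + 1))" using q by (intro mult_left_mono mult_right_mono) auto
      finally have "5 \<le> 4 * q * ((2 * real n + 1) / (2 * (real n + 2)))" by (simp add: field_simps)
      from mult_left_mono[OF this pos] show ?thesis by (simp add: catn_Suc mult_ac)
    qed
    with Suc.IH show ?thesis unfolding sum.lessThan_Suc by linarith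
  qed
qed

lemma norm_power_minus_1_le:
  fixes a :: complex
  shows "norm ((1 - a) ^ k - 1) \<le> real k * norm a * (1 + norm a) ^ k"
proof (induction k)
  case (Suc k)
  have n: "norm (1 - a) \<le> 1 + norm a" using norm_triangle_ineq4[of 1 a] by simp
  have "(1 - a) ^ Suc k - 1 = (1 - a) * ((1 - a) ^ k - 1) - a" by (simp add: algebra_simps)
  then have "norm ((1 - a) ^ Suc k - 1) \<le> norm (1 - a) * norm ((1 - a) ^ k - 1) + norm a"
    using norm_triangle_ineq4[of "(1 - a) * ((1 - a) ^ k - 1)" a] by (simp add: norm_mult)
  also have "\<dots> \<le> (1 + norm a) * (real k * norm a * (1 + norm a) ^ k) + norm a * (1 + norm a) ^ Suc k"
    using n Suc.IH mult_left_mono[OF one_le_power[of "1 + norm a" "Suc k"], of "norm a"]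
    by (intro add_mono mult_mono) auto
  also have "\<dots> = real (Suc k) * norm a * (1 + norm a) ^ Suc k" by (simp add: algebra_simps)
  finally show ?case .
qed simp

lemma power_one_plus_le_3:
  assumes "0 \<le> x" "real n * x \<le> 1"
  shows "(1 + x) ^ n \<le> (3::real)"
proof -
  have "(1 + x) ^ n \<le> exp x ^ n" using assms by (intro power_mono) auto
  also have "\<dots> = exp (real n * x)" by (simp add: exp_of_nat_mult)
  also have "\<dots> \<le> exp 1" using assms by simp
  also have "\<dots> \<le> 3" by (rule exp_le)
  finally show ?thesis .
qed

text \<open>\<open>K\<close> is the crossover index: up to it the summand 4m z^(k+1) governs the
  size of the radicand of \<open>avoid_disc\<close>, beyond it 1 - 4mz does.\<close>

locale near_singularity =
  fixes m K :: nat and z :: complex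
  assumes m: "m \<ge> 1" and K: "K \<ge> 1" and zD: "z \<in> domD m"
    and upper: "norm (1 - 4 * of_nat m * z) * (4 * real m) ^ K \<le> 1"
    and lower: "1 < norm (1 - 4 * of_nat m * z) * (4 * real m) ^ Suc K"
begin

definition a :: complex where "a = 1 - 4 * of_nat m * z"
definition s :: complex where "s = csqrt a"
definition q :: real where "q = sqrt (4 * real m)"

lemma a_not_nonpos: "a \<notin> \<real>\<^sub>\<le>\<^sub>0"
  using base_notin_nonpos[OF m zD] by (simp add: a_def)

lemma a_pos: "norm a > 0"
  using a_not_nonpos by auto

lemma q_ge: "q \<ge> 2" and q_sq: "q ^ 2 = 4 * real m"
  using m by (auto simp: q_def real_le_rsqrt)

lemma z_eq: "4 * of_nat m * z = 1 - a"
  by (simp add: a_def)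

lemma norm_z: "4 * real m * norm z = norm (1 - a)"
  unfolding z_eq[symmetric] norm_mult by simp

lemma norm_1_a: "norm (1 - a) \<le> 1 + norm a" "1 - norm a \<le> norm (1 - a)"
  using norm_triangle_ineq4[of 1 a] norm_triangle_ineq2[of 1 a] by auto

lemma norm_s: "norm s = sqrt (norm a)"
  by (simp add: s_def)

lemma norm_s_le: "norm s * q ^ K \<le> 1"
proof (rule power2_le_imp_le)
  have "(norm s * q ^ K) ^ 2 = norm a * (q ^ 2) ^ K"
    by (simp add: norm_s power_mult_distrib power_mult[symmetric] mult.commute)
  also have "\<dots> \<le> 1 ^ 2" using upper by (simp add: q_sq a_def)
  finally show "(norm s * q ^ K) ^ 2 \<le> 1 ^ 2" .
qed simp

lemma a_4K: "norm a * 4 ^ K \<le> 1"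
proof -
  have "norm a * 4 ^ K \<le> norm a * (4 * real m) ^ K"
    using m by (intro mult_left_mono power_mono) auto
  with upper show ?thesis by (simp add: a_def)
qed

text \<open>Powers of 1 - a with exponent up to 2(K+1) thereby stay bounded.\<close>

lemma a_K: "real (2 * Suc K) * norm a \<le> 1"
proof -
  have "2 * Suc K \<le> 4 ^ K" using K by (induction K rule: nat_induct_at_least) auto
  then have "real (2 * Suc K) \<le> 4 ^ K" by (metis of_nat_le_iff of_nat_numeral of_nat_power)
  then have "real (2 * Suc K) * norm a \<le> 4 ^ K * norm a" by (intro mult_right_mono) auto
  with a_4K show ?thesis by (simp add: mult.commute)
qed

lemma a_quarter: "norm a \<le> 1/4"
proof -
  have "4 * norm a \<le> real (2 * Suc K) * norm a" using K by (intro mult_right_mono) auto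
  with a_K show ?thesis by simp
qed

lemma power_1_a_le: "j \<le> 2 * Suc K \<Longrightarrow> norm (1 - a) ^ j \<le> 3" 
  and power_1_a_le': "j \<le> 2 * Suc K \<Longrightarrow> (1 + norm a) ^ j \<le> 3"
proof -
  assume j: "j \<le> 2 * Suc K"
  have "(1 + norm a) ^ j \<le> (1 + norm a) ^ (2 * Suc K)"
    using j by (intro power_increasing) auto
  also have "\<dots> \<le> 3" by (intro power_one_plus_le_3 a_K) auto
  finally show *: "(1 + norm a) ^ j \<le> 3" .
  have "norm (1 - a) ^ j \<le> (1 + norm a) ^ j" by (intro power_mono norm_1_a) auto
  with * show "norm (1 - a) ^ j \<le> 3" by simp
qed

lemma power_1_a_ge: "j \<le> Suc K \<Longrightarrow> norm (1 - a) ^ j \<ge> 1/2"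
proof -
  assume j: "j \<le> Suc K"
  have "1/2 \<le> 1 + real (Suc K) * (- norm a)" using a_K by (simp add: algebra_simps)
  also have "\<dots> \<le> (1 - norm a) ^ Suc K"
    using a_quarter Bernoulli_inequality[of "- norm a" "Suc K"] by simp
  also have "\<dots> \<le> (1 - norm a) ^ j"
    using j a_quarter by (intro power_decreasing) auto
  also have "\<dots> \<le> norm (1 - a) ^ j"
    using a_quarter by (intro power_mono norm_1_a) auto
  finally show ?thesis .
qed

lemma norm_csqrt_sum_lower:
  assumes "k < K"
  shows "1 / (2 * q ^ Suc k) \<le> norm (csqrt_sum m (Suc k) z)"
proof (rule power2_le_imp_le)
  have "(1 / (2 * q ^ Suc k)) ^ 2 = 1 / (4 * (q ^ 2) ^ Suc k)"
    by (simp add: power_divide power_mult_distrib power_mult[symmetric] mult.commute)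
  also have "\<dots> \<le> (1/2) / (4 * real m) ^ Suc k"
    using m by (simp add: q_sq field_simps)
  also have "\<dots> \<le> norm (1 - a) ^ Suc (Suc k) / (4 * real m) ^ Suc k"
    using assms by (intro divide_right_mono power_1_a_ge) auto
  also have "\<dots> = 4 * real m * norm z ^ (Suc k + 1)"
    using m by (simp add: norm_z[symmetric] power_mult_distrib)
  also have "\<dots> \<le> norm (csqrt_sum m (Suc k) z) ^ 2"
    by (rule norm_csqrt_sum_ge[OF m zD]) simp
  finally show "(1 / (2 * q ^ Suc k)) ^ 2 \<le> norm (csqrt_sum m (Suc k) z) ^ 2" .
qed simp

text \<open>The sum grows like \<open>catn K * q ^ K\<close>, and the factor \<open>s\<close>
  cancels \<open>q ^ K\<close> by \<open>norm_s_le\<close>. The constant is 48 * 5.\<close>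

lemma head_bound:
  "norm (s * (\<Sum>k<K. of_real (tree_count m (Suc k)) * (2 * z ^ k / csqrt_sum m (Suc k) z))) \<le> 240 * real m * catn K"
proof -
  have q0: "q > 0" using q_ge by linarith
  have "norm (of_real (tree_count m (Suc k)) * (2 * z ^ k / csqrt_sum m (Suc k) z)) \<le> 48 * real m * (catn (Suc k) * q ^ Suc k)"
    if k: "k < K" for k
  proof -
    have r: "0 < 1 / (2 * q ^ Suc k)" using q0 by simp
    have "norm (of_real (tree_count m (Suc k)) * (2 * z ^ k / csqrt_sum m (Suc k) z)) =
        4 * real m * catn (Suc k) * 2 * (norm (1 - a) ^ k / norm (csqrt_sum m (Suc k) z))"
      unfolding norm_mult norm_divide norm_power norm_z[symmetric] norm_of_real abs_of_nonneg[OF tree_count_nonneg]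
      by (simp add: tree_count_def power_mult_distrib)
    also have "\<dots> \<le> 4 * real m * catn (Suc k) * 2 * (3 / (1 / (2 * q ^ Suc k)))"
      using catn_pos[of "Suc k"] k
      by (intro mult_left_mono frac_le power_1_a_le norm_csqrt_sum_lower r) auto
    finally show ?thesis by simp
  qed
  then have "norm (\<Sum>k<K. of_real (tree_count m (Suc k)) * (2 * z ^ k / csqrt_sum m (Suc k) z)) \<le> (\<Sum>k<K. 48 * real m * (catn (Suc k) * q ^ Suc k))"
    by (intro sum_norm_le) auto
  also have "\<dots> = 48 * real m * (\<Sum>k<K. catn (Suc k) * q ^ Suc k)"
    by (simp only: sum_distrib_left)
  also have "\<dots> \<le> 48 * real m * (5 * (catn K * q ^ K))"
    by (intro mult_left_mono catn_geometric_sum_le q_ge K) auto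
  finally have "norm s * norm (\<Sum>k<K. of_real (tree_count m (Suc k)) * (2 * z ^ k / csqrt_sum m (Suc k) z)) \<le> norm s * (48 * real m * (5 * (catn K * q ^ K)))"
    by (intro mult_left_mono) auto
  also have "\<dots> = 240 * real m * catn K * (norm s * q ^ K)" by simp
  also have "\<dots> \<le> 240 * real m * catn K * 1"
    using catn_pos[of K] by (intro mult_left_mono norm_s_le) auto
  finally show ?thesis by (simp add: norm_mult)
qed

text \<open>The choice of \<open>K\<close> gives \<open>\<rho> ^ Suc K \<le> 3 * norm a\<close>,
  which absorbs the denominator in \<open>norm_corr_term_le\<close>; the rest is a geometric series
  of ratio at most 1/2.\<close>

lemma tail_bound: "norm (4 * of_nat m * (\<Sum>k. corr_term m (k + K) z)) \<le> 24 * real m * catn K"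
proof -
  define \<rho> where "\<rho> = 4 * real m * norm z ^ 2"
  have \<rho>_eq: "\<rho> = norm (1 - a) ^ 2 / (4 * real m)"
    using m by (simp add: \<rho>_def norm_z[symmetric] power2_eq_square)
  have "norm (1 - a) \<le> 5/4" using norm_1_a a_quarter by linarith
  then have "norm (1 - a) ^ 2 \<le> (5/4) ^ 2" by (intro power_mono) auto
  then have "\<rho> \<le> (5/4) ^ 2 / 4" unfolding \<rho>_eq using m by (intro frac_le) auto
  then have \<rho>: "0 \<le> \<rho>" "\<rho> \<le> 1/2" by (auto simp: \<rho>_def power2_eq_square)
  have "\<rho> ^ Suc K = norm (1 - a) ^ (2 * Suc K) / (4 * real m) ^ Suc K"
    unfolding \<rho>_eq power_divide power_mult ..
  also have "\<dots> \<le> 3 / (4 * real m) ^ Suc K"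
    by (intro divide_right_mono power_1_a_le) auto
  also have "\<dots> \<le> 3 * norm a"
    using lower[folded a_def] m by (simp add: divide_le_eq del: power_Suc)
  finally have \<rho>K: "\<rho> ^ Suc K \<le> 3 * norm a" .
  have le: "norm (corr_term m (k + K) z) \<le> (3 * catn K) * \<rho> ^ k" for k
  proof -
    have "norm (corr_term m (k + K) z) \<le> catn (Suc (k + K)) * \<rho> ^ Suc (k + K) / norm a"
      unfolding \<rho>_def a_def by (rule norm_corr_term_le[OF m zD])
    also have "\<dots> \<le> catn K * \<rho> ^ Suc (k + K) / norm a"
      using \<rho> by (intro divide_right_mono mult_right_mono catn_antimono) auto
    also have "\<dots> = catn K * \<rho> ^ k * (\<rho> ^ Suc K / norm a)"
      by (simp add: power_add)
    also have "\<dots> \<le> catn K * \<rho> ^ k * 3"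
      using \<rho>K a_pos catn_pos[of K] \<rho> by (intro mult_left_mono) (auto simp: field_simps)
    finally show ?thesis by simp
  qed
  have sg: "(\<lambda>k. \<rho> ^ k) sums (1 / (1 - \<rho>))" using \<rho> by (intro geometric_sums) auto
  have sm: "summable (\<lambda>k. (3 * catn K) * \<rho> ^ k)" using sg by (intro summable_mult) (auto simp: sums_iff)
  have sn: "summable (\<lambda>k. norm (corr_term m (k + K) z))"
    by (rule summable_comparison_test'[OF sm]) (use le in auto)
  have "norm (\<Sum>k. corr_term m (k + K) z) \<le> (\<Sum>k. (3 * catn K) * \<rho> ^ k)"
    by (intro order_trans[OF summable_norm[OF sn]] suminf_le le sn sm)
  also have "\<dots> = 3 * catn K * (1 / (1 - \<rho>))"
    using sums_mult[OF sg, of "3 * catn K"] by (simp add: sums_iff)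
  also have "\<dots> \<le> 3 * catn K * 2"
    using \<rho> catn_pos[of K] by (intro mult_left_mono) (auto simp: field_simps)
  finally have "4 * real m * norm (\<Sum>k. corr_term m (k + K) z) \<le> 4 * real m * (3 * catn K * 2)"
    by (intro mult_left_mono) auto
  then show ?thesis by (simp add: norm_mult)
qed

text \<open>At a = 0 the closed form is 4m and the partial sum is 4m(1 - 2 cbin(K+1)), whose
  difference is the main term. Replacing \<open>a\<close> by 0 costs O(|s|) in the former and
  O(K|a|) in the latter.\<close>

lemma algebraic_part_bound:
  "norm (4 * of_nat m / (1 + s) ^ 2 - (\<Sum>k<K. of_real (tree_count m (Suc k)) * z ^ k) - of_real (8 * real m * cbin (Suc K)))
     \<le> 12 * real m * (norm s + real K * norm a)"
proof -
  have Re_s: "Re s \<ge> 0" by (simp only: s_def Re_csqrt)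
  have s1: "norm s \<le> 1" using a_quarter by (simp add: norm_s)
  have "1 \<le> Re (1 + s)" using Re_s by simp
  then have ge: "1 \<le> norm (1 + s)" using complex_Re_le_cmod[of "1 + s"] by linarith
  then have nz: "1 + s \<noteq> 0" by auto
  have "1 / (1 + s) ^ 2 - 1 = - (s * (2 + s)) / (1 + s) ^ 2"
  proof -
    have "1 / (1 + s) ^ 2 - 1 = (1 - (1 + s) ^ 2) / (1 + s) ^ 2" using nz by (simp add: diff_divide_distrib)
    also have "1 - (1 + s) ^ 2 = - (s * (2 + s))" by (simp add: power2_eq_square algebra_simps)
    finally show ?thesis .
  qed
  then have "norm (1 / (1 + s) ^ 2 - 1) = norm s * norm (2 + s) / norm (1 + s) ^ 2"
    by (simp add: norm_mult norm_divide norm_power)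
  also have "\<dots> \<le> norm s * 3 / 1"
    using ge s1 norm_triangle_ineq[of 2 s] by (intro frac_le mult_left_mono) auto
  finally have A: "norm (1 / (1 + s) ^ 2 - 1) \<le> 3 * norm s" by simp
  \<comment> \<open>The sum runs over \<open>catn 1\<close> to \<open>catn K\<close>; the missing
    \<open>catn 0 = 1\<close> turns 2 into 1.\<close>
  have sum1: "(\<Sum>k<K. catn (Suc k)) = 1 - 2 * cbin (Suc K)"
    using sum_catn[of "Suc K"] by (simp add: sum.lessThan_Suc_shift del: sum.lessThan_Suc)
  have "norm (\<Sum>k<K. of_real (catn (Suc k)) * ((1 - a) ^ k - 1)) \<le> (\<Sum>k<K. catn (Suc k) * (3 * (real K * norm a)))"
  proof (rule sum_norm_le)
    fix k assume k: "k \<in> {..<K}"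
    have "norm ((1 - a) ^ k - 1) \<le> real k * norm a * (1 + norm a) ^ k" by (rule norm_power_minus_1_le)
    also have "\<dots> \<le> real K * norm a * 3"
      using k by (intro mult_mono power_1_a_le') auto
    finally show "norm (of_real (catn (Suc k)) * ((1 - a) ^ k - 1)) \<le> catn (Suc k) * (3 * (real K * norm a))"
      using catn_pos[of "Suc k"] by (simp add: norm_mult)
  qed
  also have "\<dots> = (1 - 2 * cbin (Suc K)) * (3 * (real K * norm a))"
    unfolding sum1[symmetric] sum_distrib_right ..
  also have "\<dots> \<le> 3 * (real K * norm a)"
  proof (rule mult_left_le_one_le)
    show "0 \<le> 1 - 2 * cbin (Suc K)"
      unfolding sum1[symmetric] by (intro sum_nonneg less_imp_le[OF catn_pos])
    show "1 - 2 * cbin (Suc K) \<le> 1" using cbin_pos[of "Suc K"] by simp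
  qed auto
  finally have B: "norm (\<Sum>k<K. of_real (catn (Suc k)) * ((1 - a) ^ k - 1)) \<le> 3 * (real K * norm a)" .
  have "(\<Sum>k<K. of_real (tree_count m (Suc k)) * z ^ k) = 4 * of_nat m * (\<Sum>k<K. of_real (catn (Suc k)) * (1 - a) ^ k)"
    unfolding sum_distrib_left z_eq[symmetric]
    by (intro sum.cong refl) (simp add: tree_count_def power_mult_distrib)
  also have "(\<Sum>k<K. of_real (catn (Suc k)) * (1 - a) ^ k) =
     (\<Sum>k<K. of_real (catn (Suc k)) * ((1 - a) ^ k - 1)) + of_real (1 - 2 * cbin (Suc K))"
    unfolding sum1[symmetric] of_real_sum sum.distrib[symmetric] by (simp add: algebra_simps)
  finally have "4 * of_nat m / (1 + s) ^ 2 - (\<Sum>k<K. of_real (tree_count m (Suc k)) * z ^ k) - of_real (8 * real m * cbin (Suc K)) =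
     4 * of_nat m * ((1 / (1 + s) ^ 2 - 1) - (\<Sum>k<K. of_real (catn (Suc k)) * ((1 - a) ^ k - 1)))"
    by (simp add: ring_distribs)
  also have "norm \<dots> = 4 * real m * norm ((1 / (1 + s) ^ 2 - 1) - (\<Sum>k<K. of_real (catn (Suc k)) * ((1 - a) ^ k - 1)))"
    by (simp add: norm_mult)
  also have "\<dots> \<le> 4 * real m * (3 * norm s + 3 * (real K * norm a))"
    by (intro mult_left_mono order_trans[OF norm_triangle_ineq4] add_mono A B) auto
  finally show ?thesis by (simp add: algebra_simps)
qed

lemma catn_le: "catn K \<le> 1 / (real K * sqrt (real K))"
proof -
  have "(cbin K * sqrt (real K)) ^ 2 * 1 \<le> (cbin K * sqrt (real K)) ^ 2 * pi"
    using pi_gt3 by (intro mult_left_mono) auto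
  also have "\<dots> = pi * cbin K ^ 2 * real K" by (simp add: power_mult_distrib)
  also have "\<dots> \<le> 1" by (rule cbin_upper)
  finally have "cbin K * sqrt (real K) \<le> 1"
    using power2_le_imp_le[of "cbin K * sqrt (real K)" 1] by simp
  then have "cbin K \<le> 1 / sqrt (real K)" using K by (simp add: field_simps)
  then have "catn K \<le> 1 / sqrt (real K) / real K"
    unfolding catn_def using K cbin_pos[of K] by (intro frac_le) auto
  then show ?thesis by (simp add: mult.commute)
qed

text \<open>The left side is at most 2|s|, and |s| is at most 2^(-K), which beats any power of
  \<open>K\<close>.\<close>

lemma small_le: "norm s + real K * norm a \<le> 4 / (real K * sqrt (real K))"
proof -
  have "norm s * 2 ^ K \<le> norm s * q ^ K" using q_ge by (intro mult_left_mono power_mono) auto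
  with norm_s_le have s2: "norm s * 2 ^ K \<le> 1" by linarith
  have pow: "K ^ 2 \<le> 2 * 2 ^ K"
  proof (induction K)
    case (Suc n)
    show ?case
    proof (cases "n < 3")
      case True
      then have "n = 0 \<or> n = 1 \<or> n = 2" by auto
      then show ?thesis by (auto simp: power2_eq_square)
    next
      case False
      then have "3 * n \<le> n * n" by (intro mult_right_mono) auto
      then have "Suc n ^ 2 \<le> 2 * n ^ 2"
        unfolding power2_eq_square mult_Suc mult_Suc_right using False by linarith
      with Suc show ?thesis by simp
    qed
  qed simp
  have pow': "real K ^ 2 \<le> 2 * 2 ^ K" using of_nat_mono[OF pow, where 'a = real] by simp
  have "real K * sqrt (real K) \<le> real K ^ 2"
    unfolding power2_eq_square using K by (intro mult_left_mono) (auto intro!: real_le_lsqrt simp: power2_eq_square)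
  with pow' have Ks: "real K * sqrt (real K) \<le> 2 * 2 ^ K" by linarith
  have a: "norm a = norm s ^ 2" by (simp add: norm_s)
  have "real K \<le> 2 ^ K" using of_nat_mono[OF less_imp_le[OF less_exp[of K]], where 'a = real] by simp
  then have "real K * norm s \<le> 2 ^ K * norm s" by (intro mult_right_mono) auto
  with s2 have "real K * norm s \<le> 1" by (simp add: mult.commute)
  then have "real K * norm s * norm s \<le> 1 * norm s" by (intro mult_right_mono) auto
  then have "norm s + real K * norm a \<le> 2 * norm s" by (simp add: a power2_eq_square)
  then have "(norm s + real K * norm a) * (real K * sqrt (real K)) \<le> 2 * norm s * (2 * 2 ^ K)"
    by (intro mult_mono[OF _ Ks]) auto
  also have "\<dots> \<le> 4" using s2 by simp
  finally show ?thesis using K by (simp add: field_simps)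
qed

text \<open>The constant collects 240 from the head, 24 from the tail and 12 * 4 from the algebraic
  part.\<close>

lemma main_estimate:
  "norm (s * NB_fun m z - of_real (8 * real m * cbin (Suc K))) \<le> 312 * real m / (real K * sqrt (real K))"
proof -
  define X Y Z where "X = s * (\<Sum>k<K. of_real (tree_count m (Suc k)) * (2 * z ^ k / csqrt_sum m (Suc k) z))"
    and "Y = 4 * of_nat m / (1 + s) ^ 2 - (\<Sum>k<K. of_real (tree_count m (Suc k)) * z ^ k) - of_real (8 * real m * cbin (Suc K))"
    and "Z = 4 * of_nat m * (\<Sum>k. corr_term m (k + K) z)"
  define e where "e = 1 / (real K * sqrt (real K))"
  have "s * NB_fun m z - of_real (8 * real m * cbin (Suc K)) = X + Y - Z"
    using NB_fun_split[OF m zD, of K] by (simp add: X_def Y_def Z_def s_def a_def)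
  moreover have "norm (X + Y - Z) \<le> norm X + norm Y + norm Z"
    using norm_triangle_ineq4[of "X + Y" Z] norm_triangle_ineq[of X Y] by linarith
  moreover have "norm X \<le> 240 * real m * e"
    using head_bound mult_left_mono[OF catn_le, of "240 * real m"] unfolding X_def e_def by linarith
  moreover have "norm Z \<le> 24 * real m * e"
    using tail_bound mult_left_mono[OF catn_le, of "24 * real m"] unfolding Z_def e_def by linarith
  moreover have "norm Y \<le> 12 * real m * (4 * e)"
    using algebraic_part_bound mult_left_mono[OF small_le, of "12 * real m"] unfolding Y_def e_def by simp
  ultimately have "norm (s * NB_fun m z - of_real (8 * real m * cbin (Suc K))) \<le> 312 * real m * e" by simp
  then show ?thesis by (simp add: e_def)
qed

end

text \<open>The imaginary parts of \<open>a\<close> and Ln(1/a) have opposite signs, and the bound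
  on |a| puts Ln(1/a) in the right half-plane. So the product of the two roots has positive real
  part and is the principal root.\<close>

lemma csqrt_mult_Ln_inverse:
  assumes "a \<notin> \<real>\<^sub>\<le>\<^sub>0" "norm a < exp (-pi)"
  shows "csqrt (a * Ln (inverse a)) = csqrt a * csqrt (Ln (inverse a))"
proof -
  have a0: "a \<noteq> 0" using assms(1) by auto
  define l where "l = Ln (inverse a)"
  have l: "l = - Ln a" unfolding l_def using assms(1) by (rule Ln_inverse)
  have "ln (norm a) < - pi" using assms(2) a0 by (metis ln_exp ln_less_cancel_iff exp_gt_zero zero_less_norm_iff)
  moreover have "Re l = - ln (norm a)" using a0 by (simp add: l)
  ultimately have Re_l: "Re l > 0" using pi_gt_zero by linarith
  have l_np: "l \<notin> \<real>\<^sub>\<le>\<^sub>0" using Re_l by (auto simp: complex_nonpos_Reals_iff)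
  define p q where "p = csqrt a" and "q = csqrt l"
  have pos: "Re p > 0" "Re q > 0" unfolding p_def q_def by (intro Re_csqrt_pos assms l_np)+
  have sq: "a = p ^ 2" "l = q ^ 2" by (simp_all add: p_def q_def)
  have "Im a * Im l \<le> 0"
  proof (cases "Im a \<ge> 0")
    case True
    then have "Im (Ln a) \<ge> 0" using Im_Ln_pos_le[OF a0] by simp
    with True show ?thesis by (simp add: l mult_nonneg_nonneg)
  next
    case False
    then have "Im (Ln a) < 0" using Im_Ln_pos_le[OF a0] Im_Ln_le_pi[OF a0] by linarith
    with False show ?thesis by (simp add: l mult_nonpos_nonpos)
  qed
  moreover have "Im a * Im l = (4 * (Re p * Re q)) * (Im p * Im q)"
    by (simp add: sq power2_eq_square)
  moreover have "4 * (Re p * Re q) > 0" using pos by simp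
  ultimately have "Im p * Im q \<le> 0"
    using mult_le_0_iff[of "4 * (Re p * Re q)" "Im p * Im q"] by linarith
  moreover have "Re p * Re q > 0" using pos by simp
  ultimately have "Re (p * q) > 0" by simp
  then have "csqrt (a * l) = p * q"
    by (intro csqrt_unique) (auto simp: sq power_mult_distrib)
  then show ?thesis by (simp add: p_def q_def l_def)
qed

text \<open>Rationalize the difference of the roots; their sum has real part at least
  \<open>sqrt V\<close>.\<close>

lemma inverse_csqrt_diff_le:
  fixes l :: complex and V :: real
  assumes V: "V > 0" and l: "l \<noteq> 0"
  shows "norm (of_real (1 / sqrt V) - 1 / csqrt l) \<le> norm (l - of_real V) / (V * sqrt (norm l))"
proof -
  define p where "p = csqrt l"
  define v where "v = complex_of_real (sqrt V)"
  have nz: "p \<noteq> 0" "v \<noteq> 0" using l V by (auto simp: p_def v_def)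
  have "v ^ 2 = of_real V" using V by (simp add: v_def flip: of_real_power)
  moreover have "p ^ 2 = l" by (simp add: p_def)
  ultimately have e: "(p - v) * (p + v) = l - of_real V" by (simp add: power2_eq_square algebra_simps)
  have "Re (p + v) \<ge> sqrt V" using Re_csqrt[of l] by (simp add: p_def v_def del: csqrt.sel)
  then have ge: "norm (p + v) \<ge> sqrt V" using complex_Re_le_cmod[of "p + v"] by linarith
  have "norm (p - v) * sqrt V \<le> norm (p - v) * norm (p + v)" by (intro mult_left_mono ge) auto
  also have "\<dots> = norm (l - of_real V)" unfolding e[symmetric] norm_mult ..
  finally have "norm (p - v) \<le> norm (l - of_real V) / sqrt V" using V by (simp add: field_simps)
  have "of_real (1 / sqrt V) - 1 / csqrt l = (p - v) / (v * p)"
    using nz unfolding p_def[symmetric] by (simp add: v_def[symmetric] field_simps)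
  also have "norm \<dots> = norm (p - v) / (sqrt V * sqrt (norm l))"
    using V by (simp add: norm_divide norm_mult v_def p_def)
  also have "\<dots> \<le> (norm (l - of_real V) / sqrt V) / (sqrt V * sqrt (norm l))"
    using V by (intro divide_right_mono \<open>norm (p - v) \<le> _\<close>) auto
  also have "\<dots> = norm (l - of_real V) / (V * sqrt (norm l))" using V by simp
  finally show ?thesis .
qed

context near_singularity
begin

text \<open>In the proof, \<open>V\<close> is the real number with \<open>cbin (Suc K) = kappa m / sqrt V\<close>; it differs from \<open>Ln (inverse a)\<close> by \<open>O(1)\<close>.\<close>

lemma asymptotic_estimate:
  assumes small: "norm a < exp (-pi)"
  defines "b \<equiv> ln (4 * real m)"
  shows "norm (NB_fun m z - of_real (8 * real m * kappa m) / csqrt (a * Ln (inverse a)))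
     \<le> ((312 * real m + 48 * real m * kappa m * b) * (6 * b * sqrt (6 * b)))
        * norm (1 / csqrt (a * Ln (inverse a) ^ 3))"
proof -
  define l where "l = Ln (inverse a)"
  define e where "e = 1 / (real K * sqrt (real K))"
  have a0: "a \<noteq> 0" using a_pos by auto
  have s0: "s \<noteq> 0" using a0 by (simp add: s_def)
  have "exp (1::real) \<le> 4 * real m" using m by (intro order.trans[OF exp_le]) simp
  then have b: "b \<ge> 1" unfolding b_def using m by (subst ln_ge_iff) auto
  have l: "l = - Ln a" unfolding l_def by (rule Ln_inverse[OF a_not_nonpos])
  have Re_l: "Re l = - ln (norm a)" using a0 by (simp add: l)
  have ln_eq: "ln (norm a * (4 * real m) ^ j) = ln (norm a) + real j * b" for j
    unfolding b_def using m a_pos ln_realpow[of "4 * real m" j] by (subst ln_mult) auto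
  \<comment> \<open>Taking logarithms of the two inequalities that fix \<open>K\<close> places
    \<open>Re l\<close> between \<open>K * b\<close> and \<open>K * b + b\<close>.\<close>
  have "ln (norm a * (4 * real m) ^ K) \<le> 0"
    using upper m a_pos by (subst ln_le_zero_iff) (auto simp: a_def)
  then have "ln (norm a) + real K * b \<le> 0" unfolding ln_eq .
  then have Re1: "real K * b \<le> Re l" by (simp add: Re_l)
  have "0 < ln (norm a * (4 * real m) ^ Suc K)"
    using lower by (intro ln_gt_zero) (simp add: a_def)
  then have "0 < ln (norm a) + real (Suc K) * b" unfolding ln_eq .
  then have Re2: "Re l \<le> real K * b + b" by (simp add: Re_l algebra_simps)
  have Im: "\<bar>Im l\<bar> \<le> 4"
    using mpi_less_Im_Ln[OF a0] Im_Ln_le_pi[OF a0] pi_less_4 by (simp add: l)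
  have Kb: "real K * b \<ge> b" "b > 0" using K b by auto
  have nl: "norm l \<le> 6 * b * real K"
  proof -
    have "norm l \<le> \<bar>Re l\<bar> + \<bar>Im l\<bar>" by (rule cmod_le)
    also have "\<dots> \<le> real K * b + b + 4 * b" using Re1 Re2 Im Kb b by linarith
    also have "\<dots> \<le> 6 * b * real K" using Kb by (simp add: mult_ac)
    finally show ?thesis .
  qed
  have nl': "real K \<le> norm l"
  proof -
    have "real K \<le> real K * b" using b by (simp add: mult_le_cancel_left1)
    with Re1 complex_Re_le_cmod[of l] show ?thesis by linarith
  qed
  have l0: "l \<noteq> 0" using nl' K by auto
  define c where "c = cbin (Suc K)"
  have c: "c > 0" unfolding c_def by (rule cbin_pos)
  define V where "V = b / (pi * c ^ 2)"
  have V: "V > 0" using Kb c by (simp add: V_def)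
  \<comment> \<open>The two Wallis bounds place \<open>V\<close> between \<open>K * b + b\<close>
    and \<open>K * b + 3/2 * b\<close>.\<close>
  have "pi * c ^ 2 * real (Suc K) \<le> 1" unfolding c_def by (rule cbin_upper)
  then have "b * (pi * c ^ 2 * real (Suc K)) \<le> b * 1" using b by (intro mult_left_mono) auto
  then have V1: "real K * b + b \<le> V" using c by (simp add: V_def field_simps)
  have "1 \<le> pi * c ^ 2 * (real (Suc K) + 1/2)" unfolding c_def by (rule cbin_lower)
  then have "b * 1 \<le> b * (pi * c ^ 2 * (real (Suc K) + 1/2))" using b by (intro mult_left_mono) auto
  then have V2: "V \<le> real K * b + 3/2 * b" using c by (simp add: V_def field_simps)
  have kc: "kappa m * (1 / sqrt V) = c"
    using c Kb by (simp add: kappa_def V_def b_def[symmetric] real_sqrt_divide real_sqrt_mult)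
  have k0: "kappa m \<ge> 0" using Kb by (simp add: kappa_def b_def[symmetric])
  have "norm (l - of_real V) \<le> \<bar>Re (l - of_real V)\<bar> + \<bar>Im (l - of_real V)\<bar>" by (rule cmod_le)
  \<comment> \<open>The real parts differ by at most 3/2 * b, and the imaginary part is at most 4,
    hence at most 4 * b.\<close>
  also have "\<dots> \<le> 6 * b" using Re1 Re2 Im V1 V2 b by simp
  finally have lV: "norm (l - of_real V) \<le> 6 * b" .
  have "norm (of_real (1 / sqrt V) - 1 / csqrt l) \<le> norm (l - of_real V) / (V * sqrt (norm l))"
    by (rule inverse_csqrt_diff_le[OF V l0])
  also have "\<dots> \<le> 6 * b / (real K * sqrt (real K))"
  proof (intro frac_le lV mult_mono)
    have "real K \<le> real K * b" using b by (simp add: mult_le_cancel_left1)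
    then show "real K \<le> V" using V1 Kb by linarith
  qed (use nl' K b V in auto)
  finally have diff: "norm (of_real (1 / sqrt V) - 1 / csqrt l) \<le> 6 * b * e" by (simp add: e_def)
  have "norm (s * NB_fun m z - of_real (8 * real m * kappa m) / csqrt l) \<le>
     norm (s * NB_fun m z - of_real (8 * real m * c)) + norm (of_real (8 * real m * kappa m) * (of_real (1 / sqrt V) - 1 / csqrt l))"
  proof -
    have "of_real (8 * real m * c) = complex_of_real (8 * real m * kappa m) * of_real (1 / sqrt V)"
      unfolding kc[symmetric] by simp
    then have "s * NB_fun m z - of_real (8 * real m * kappa m) / csqrt l =
       (s * NB_fun m z - of_real (8 * real m * c)) + of_real (8 * real m * kappa m) * (of_real (1 / sqrt V) - 1 / csqrt l)"
      by (simp add: algebra_simps)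
    then show ?thesis by (metis norm_triangle_ineq)
  qed
  also have "\<dots> \<le> 312 * real m * e + 8 * real m * kappa m * (6 * b * e)"
  proof (rule add_mono)
    show "norm (s * NB_fun m z - of_real (8 * real m * c)) \<le> 312 * real m * e"
      using main_estimate by (simp add: c_def e_def)
    have "norm (complex_of_real (8 * real m * kappa m) * (of_real (1 / sqrt V) - 1 / csqrt l)) =
       8 * real m * kappa m * norm (of_real (1 / sqrt V) - 1 / csqrt l)"
      unfolding norm_mult norm_of_real using k0 by simp
    also have "\<dots> \<le> 8 * real m * kappa m * (6 * b * e)"
      using k0 by (intro mult_left_mono diff) auto
    finally show "norm (complex_of_real (8 * real m * kappa m) * (of_real (1 / sqrt V) - 1 / csqrt l)) \<le> 8 * real m * kappa m * (6 * b * e)" .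
  qed
  also have "\<dots> = (312 * real m + 48 * real m * kappa m * b) * e" by (simp add: algebra_simps)
  finally have main: "norm (s * NB_fun m z - of_real (8 * real m * kappa m) / csqrt l)
     \<le> (312 * real m + 48 * real m * kappa m * b) * e" .
  \<comment> \<open>Trades the power K^(3/2) for |l|^(3/2), using \<open>nl\<close>.\<close>
  have "e \<le> 6 * b * sqrt (6 * b) / sqrt (norm l ^ 3)"
  proof -
    have "sqrt (norm l ^ 3) \<le> sqrt ((6 * b * real K) ^ 3)"
      using nl by (intro real_sqrt_le_mono power_mono) auto
    also have "(6 * b * real K) ^ 3 = (6 * b * real K) ^ 2 * (6 * b * real K)" by (simp add: power2_eq_square power3_eq_cube)
    also have "sqrt \<dots> = 6 * b * sqrt (6 * b) * (real K * sqrt (real K))"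
      using Kb by (simp only: real_sqrt_mult real_sqrt_abs) simp
    finally have *: "sqrt (norm l ^ 3) \<le> 6 * b * sqrt (6 * b) * (real K * sqrt (real K))" .
    have "real K * sqrt (real K) > 0" "sqrt (norm l ^ 3) > 0" using K l0 by auto
    with * show ?thesis by (simp add: e_def divide_simps mult_ac)
  qed
  then have main': "norm (s * NB_fun m z - of_real (8 * real m * kappa m) / csqrt l)
     \<le> (312 * real m + 48 * real m * kappa m * b) * (6 * b * sqrt (6 * b) / sqrt (norm l ^ 3))"
    using k0 b by (intro order_trans[OF main] mult_left_mono) auto
  have "NB_fun m z - of_real (8 * real m * kappa m) / csqrt (a * l) =
      (s * NB_fun m z - of_real (8 * real m * kappa m) / csqrt l) / s"
    using s0 l0 unfolding csqrt_mult_Ln_inverse[OF a_not_nonpos small, folded l_def s_def]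
    by (simp add: field_simps)
  then have "norm (NB_fun m z - of_real (8 * real m * kappa m) / csqrt (a * l)) =
      norm (s * NB_fun m z - of_real (8 * real m * kappa m) / csqrt l) / norm s"
    by (simp only: norm_divide)
  also have "\<dots> \<le> (312 * real m + 48 * real m * kappa m * b) * (6 * b * sqrt (6 * b) / sqrt (norm l ^ 3)) / norm s"
    by (intro divide_right_mono main') auto
  also have "\<dots> = ((312 * real m + 48 * real m * kappa m * b) * (6 * b * sqrt (6 * b))) * norm (1 / csqrt (a * l ^ 3))"
    by (simp add: norm_divide norm_mult norm_power real_sqrt_mult norm_s)
  finally show ?thesis by (simp only: l_def)
qed

end

lemma ex_power_interval:
  fixes x b :: real
  assumes "b > 1" "x \<ge> b"
  obtains K where "K \<ge> 1" "b ^ K \<le> x" "x < b ^ Suc K"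
proof -
  obtain N where N: "x < b ^ N" using real_arch_pow[OF assms(1)] by blast
  define K where "K = (LEAST n. x < b ^ Suc n)"
  have "x < b ^ Suc N" using N assms by (smt (verit) power_Suc mult_le_cancel_right1 zero_less_power)
  then have 1: "x < b ^ Suc K" unfolding K_def by (rule LeastI)
  have K: "K \<ge> 1" using 1 assms by (cases K) auto
  then have "\<not> x < b ^ Suc (K - 1)" unfolding K_def by (intro not_less_Least) linarith
  with K have "b ^ K \<le> x" by simp
  with K 1 that show ?thesis by blast
qed

theorem theorem7:
  fixes m :: nat
  assumes "m \<ge> 1"
  shows "\<exists>f :: complex \<Rightarrow> complex.
     f analytic_on domD m \<and>
     (\<forall>z. norm z < 1 / (4 * real m) \<longrightarrow>
        (\<lambda>n. of_nat (NB_coeff m n) * z ^ n) sums f z) \<and>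
     (\<lambda>z. f z - complex_of_real (8 * real m * kappa m) /
          csqrt ((1 - 4 * of_nat m * z) * Ln (inverse (1 - 4 * of_nat m * z))))
       \<in> bigo (at (complex_of_real (1 / (4 * real m))) within domD m)
         (\<lambda>z. 1 / csqrt ((1 - 4 * of_nat m * z) * (Ln (inverse (1 - 4 * of_nat m * z))) ^ 3))"
proof (intro exI[of _ "NB_fun m"] conjI allI impI)
  show "NB_fun m analytic_on domD m" by (rule NB_fun_analytic[OF assms])
  show "(\<lambda>n. of_nat (NB_coeff m n) * z ^ n) sums NB_fun m z" if "norm z < 1 / (4 * real m)" for z
    by (rule NB_fun_sums[OF assms that])
  \<comment> \<open>The first bound is for splitting the square root of the product; the second
    ensures that the crossover index is at least 1.\<close>
  define \<epsilon> where "\<epsilon> = min (exp (-pi)) (1 / (4 * real m))"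
  have "\<epsilon> > 0" using assms by (simp add: \<epsilon>_def)
  let ?z0 = "complex_of_real (1 / (4 * real m))"
  have "((\<lambda>z. norm (1 - 4 * of_nat m * z)) \<longlongrightarrow> norm (1 - 4 * of_nat m * ?z0)) (at ?z0 within domD m)"
    by (intro tendsto_intros)
  moreover have "norm (1 - 4 * of_nat m * ?z0) = 0" using assms by simp
  ultimately have "\<forall>\<^sub>F z in at ?z0 within domD m. norm (1 - 4 * of_nat m * z) < \<epsilon>"
    using \<open>\<epsilon> > 0\<close> order_tendstoD(2) by metis
  moreover have "\<forall>\<^sub>F z in at ?z0 within domD m. z \<in> domD m"
    by (rule eventually_at_topological[THEN iffD2]) (auto intro: exI[of _ UNIV])
  ultimately have "\<forall>\<^sub>F z in at ?z0 within domD m.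
     norm (NB_fun m z - complex_of_real (8 * real m * kappa m) /
          csqrt ((1 - 4 * of_nat m * z) * Ln (inverse (1 - 4 * of_nat m * z))))
     \<le> ((312 * real m + 48 * real m * kappa m * ln (4 * real m)) * (6 * ln (4 * real m) * sqrt (6 * ln (4 * real m)))) *
      norm (1 / csqrt ((1 - 4 * of_nat m * z) * (Ln (inverse (1 - 4 * of_nat m * z))) ^ 3))"
  proof eventually_elim
    case (elim z)
    let ?a = "1 - 4 * of_nat m * z"
    have a0: "norm ?a > 0" using base_notin_nonpos[OF assms elim(2)] by auto
    have "norm ?a < 1 / (4 * real m)" using elim by (simp add: \<epsilon>_def)
    then have "4 * real m \<le> 1 / norm ?a" using a0 assms by (simp add: field_simps)
    \<comment> \<open>\<open>K\<close> depends on \<open>z\<close>, but the constant of the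
      resulting estimate does not.\<close>
    then obtain K where K: "K \<ge> 1" "(4 * real m) ^ K \<le> 1 / norm ?a" "1 / norm ?a < (4 * real m) ^ Suc K"
      using ex_power_interval[of "4 * real m" "1 / norm ?a"] assms by auto
    interpret near_singularity m K z
    proof
      show "norm ?a * (4 * real m) ^ K \<le> 1" "1 < norm ?a * (4 * real m) ^ Suc K"
        using K(2,3) a0 by (simp_all add: field_simps del: power_Suc)
    qed (use assms K elim in auto)
    show ?case using asymptotic_estimate elim(1) by (simp add: a_def \<epsilon>_def)
  qed
  then show "(\<lambda>z. NB_fun m z - complex_of_real (8 * real m * kappa m) /
          csqrt ((1 - 4 * of_nat m * z) * Ln (inverse (1 - 4 * of_nat m * z))))
       \<in> bigo (at (complex_of_real (1 / (4 * real m))) within domD m)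
         (\<lambda>z. 1 / csqrt ((1 - 4 * of_nat m * z) * (Ln (inverse (1 - 4 * of_nat m * z))) ^ 3))"
    by (rule bigoI)
qed

end
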